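(* For any $F,G\in L^2(\Omega)$ such that $E[\|DF\|_{\ell^2(\mathbb{N})}^2]<\infty$ and $E[\|DG\|_{\ell^2(\mathbb{N})}^2]<\infty$, $$\mathrm{Cov}(F,G)=E\left[\sum_{k=0}^\infty\int_0^\infty e^{-t}(D_kF)\,P_tD_kG\,dt\right].$$
   Context: $\mathbb{N}=\{0,1,2,\ldots\}$. Let $(p_k)_{k\in\mathbb{N}}$ be a deterministic sequence in $(0,1)$ and $q_k=1-p_k$. Let $\Omega=\{-1,1\}^{\mathbb{N}}$ with its product $\sigma$-algebra, let $X_k:\Omega\to\{-1,1\}$ be the canonical projections, and let $\mathbb{P}$ be the product probability measure under which the $X_k$ are independent with $\mathbb{P}(X_k=1)=p_k$, $\mathbb{P}(X_k=-1)=q_k$. Set $Y_k=\frac{q_k-p_k+X_k}{2\sqrt{p_kq_k}}$. For $F:\Omega\to\mathbb{R}$, $D_kF(\omega)=\sqrt{p_kq_k}\,(F(\omega_+^k)-F(\omega_-^k))$, where $\omega_\pm^k$ is $\omega$ with its $k$-th coordinate replaced by $\pm1$, and $DF=(D_kF)_{k\in\mathbb{N}}$. $\mathrm{Cov}(F,G)=E[FG]-E[F]E[G]$. Let $\ell^2(\mathbb{N})^{\circ n}$ be the space of symmetric functions in $\ell^2(\mathbb{N}^n)$, and $\Delta_n=\{(k_1,\ldots,k_n)\in\mathbb{N}^n: k_i\ne k_j,\ 1\le i<j\le n\}$. For $f_n\in\ell^2(\mathbb{N})^{\circ n}$, $n\ge1$, put $J_n(f_n)=\sum_{(i_1,\ldots,i_n)\in\Delta_n}f_n(i_1,\ldots,i_n)Y_{i_1}\cdots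 Y_{i_n}$ (convergence in $L^2(\Omega)$), and $J_0(f_0)=f_0$ for $f_0\in\mathbb{R}$. Every $F\in L^2(\Omega)$ has a chaos expansion $F=\sum_{n=0}^\infty J_n(f_n)$, orthogonal in $L^2(\Omega)$, and the Ornstein–Uhlenbeck semigroup $(P_t)_{t\ge0}$ is defined on $L^2(\Omega)$ by $P_tF=\sum_{n=0}^\infty e^{-nt}J_n(f_n)$. *)

theory Defs
  imports "HOL-Probability.Probability"
begin

text \<open>
  The sample space is the set of all \<open>\<omega> :: nat \<Rightarrow> real\<close> with values in \<open>{-1, 1}\<close>, and the
  canonical projection \<open>X\<^sub>k\<close> is \<open>\<lambda>\<omega>. \<omega> k\<close>. Multi-indices in \<open>\<nat>\<^sup>n\<close> are lists of length \<open>n\<close>.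
\<close>

definition rademacher :: "(nat \<Rightarrow> real) \<Rightarrow> (nat \<Rightarrow> real) measure" where
  "rademacher p =
     (\<Pi>\<^sub>M k\<in>UNIV. point_measure {-1, 1} (\<lambda>x. ennreal (if x = 1 then p k else 1 - p k)))"

definition Y :: "(nat \<Rightarrow> real) \<Rightarrow> nat \<Rightarrow> (nat \<Rightarrow> real) \<Rightarrow> real" where
  "Y p k \<omega> = ((1 - p k) - p k + \<omega> k) / (2 * sqrt (p k * (1 - p k)))"

definition D :: "(nat \<Rightarrow> real) \<Rightarrow> nat \<Rightarrow> ((nat \<Rightarrow> real) \<Rightarrow> real) \<Rightarrow> (nat \<Rightarrow> real) \<Rightarrow> real" where
  "D p k F \<omega> = sqrt (p k * (1 - p k)) * (F (\<omega> (k := 1)) - F (\<omega> (k := -1)))"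

definition Cov :: "'a measure \<Rightarrow> ('a \<Rightarrow> real) \<Rightarrow> ('a \<Rightarrow> real) \<Rightarrow> real" where
  "Cov M F G = (\<integral>\<omega>. F \<omega> * G \<omega> \<partial>M) - (\<integral>\<omega>. F \<omega> \<partial>M) * (\<integral>\<omega>. G \<omega> \<partial>M)"

definition L2 :: "'a measure \<Rightarrow> ('a \<Rightarrow> real) set" where
  "L2 M = {F \<in> borel_measurable M. integrable M (\<lambda>\<omega>. (F \<omega>)\<^sup>2)}"

text \<open>
  Elements of \<open>L\<^sup>2\<close> are handled through representatives, so limits, and hence the notions
  built from them below, are relations determining their value up to null sets.
\<close>

definition L2_tendsto ::
    "'a measure \<Rightarrow> ('i \<Rightarrow> 'a \<Rightarrow> real) \<Rightarrow> ('a \<Rightarrow> real) \<Rightarrow> 'i filter \<Rightarrow> bool" where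
  "L2_tendsto M S H \<F> \<longleftrightarrow>
     H \<in> L2 M \<and> (\<forall>\<^sub>F i in \<F>. S i \<in> L2 M) \<and>
     ((\<lambda>i. \<integral>\<omega>. (S i \<omega> - H \<omega>)\<^sup>2 \<partial>M) \<longlongrightarrow> 0) \<F>"

definition sym_l2 :: "nat \<Rightarrow> (nat list \<Rightarrow> real) set" where
  "sym_l2 n = {f. (\<lambda>is. (f is)\<^sup>2) summable_on {is. length is = n} \<and>
                  (\<forall>is js. length is = n \<longrightarrow> mset js = mset is \<longrightarrow> f js = f is)}"

definition \<Delta> :: "nat \<Rightarrow> nat list set" where
  "\<Delta> n = {is. length is = n \<and> distinct is}"

text \<open>
  \<open>is_multiple_integral p n f H\<close> says that \<open>H\<close> is a version of \<open>J\<^sub>n(f)\<close>. For \<open>n = 0\<close> the only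
  multi-index is \<open>[]\<close>, with empty product 1, so \<open>H = f []\<close> almost surely.
\<close>

definition is_multiple_integral ::
    "(nat \<Rightarrow> real) \<Rightarrow> nat \<Rightarrow> (nat list \<Rightarrow> real) \<Rightarrow> ((nat \<Rightarrow> real) \<Rightarrow> real) \<Rightarrow> bool" where
  "is_multiple_integral p n f H \<longleftrightarrow>
     f \<in> sym_l2 n \<and>
     L2_tendsto (rademacher p) (\<lambda>A \<omega>. \<Sum>is\<in>A. f is * (\<Prod>i\<leftarrow>is. Y p i \<omega>)) H
       (finite_subsets_at_top (\<Delta> n))"

definition chaos_expansion ::
    "(nat \<Rightarrow> real) \<Rightarrow> ((nat \<Rightarrow> real) \<Rightarrow> real) \<Rightarrow> (nat \<Rightarrow> nat list \<Rightarrow> real)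
      \<Rightarrow> (nat \<Rightarrow> (nat \<Rightarrow> real) \<Rightarrow> real) \<Rightarrow> bool" where
  "chaos_expansion p F f J \<longleftrightarrow>
     (\<forall>n. is_multiple_integral p n (f n) (J n)) \<and>
     L2_tendsto (rademacher p) (\<lambda>N \<omega>. \<Sum>n<N. J n \<omega>) F sequentially"

text \<open>\<open>is_OU p t F H\<close> says that \<open>H\<close> is a version of \<open>P\<^sub>t F\<close>.\<close>

definition is_OU ::
    "(nat \<Rightarrow> real) \<Rightarrow> real \<Rightarrow> ((nat \<Rightarrow> real) \<Rightarrow> real) \<Rightarrow> ((nat \<Rightarrow> real) \<Rightarrow> real) \<Rightarrow> bool" where
  "is_OU p t F H \<longleftrightarrow>
     (\<exists>f J. chaos_expansion p F f J \<and>
        L2_tendsto (rademacher p) (\<lambda>N \<omega>. \<Sum>n<N. exp (- real n * t) * J n \<omega>) H sequentially)"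

text \<open>
  Each \<open>P\<^sub>t F\<close> is only determined up to a null set that may depend on \<open>t\<close>. To integrate
  \<open>P\<^sub>t F(\<omega>)\<close> over \<open>t\<close> for fixed \<open>\<omega>\<close>, the versions have to be jointly measurable in \<open>(t, \<omega>)\<close>.
\<close>

definition is_OU_process ::
    "(nat \<Rightarrow> real) \<Rightarrow> ((nat \<Rightarrow> real) \<Rightarrow> real) \<Rightarrow> (real \<Rightarrow> (nat \<Rightarrow> real) \<Rightarrow> real) \<Rightarrow> bool" where
  "is_OU_process p F u \<longleftrightarrow>
     (\<lambda>(t, \<omega>). u t \<omega>) \<in> borel_measurable (restrict_space borel {0..} \<Otimes>\<^sub>M rademacher p) \<and>
     (\<forall>t\<ge>0. is_OU p t F (u t))"

end

theory Submission
  imports Defs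
begin

text \<open>
  The products \<open>Y\<^sub>A\<close> of the \<open>Y\<^sub>k\<close> with \<open>k \<in> A\<close>, for finite sets \<open>A\<close>, form an orthonormal basis of
  \<open>L\<^sup>2\<close>, and all the operators involved act on the coefficients \<open>c(F, A) = E[F Y\<^sub>A]\<close>: the semigroup
  \<open>P\<^sub>t\<close> multiplies them by \<open>exp (- |A| t)\<close>, and \<open>c(D\<^sub>k F, A)\<close> equals \<open>c(F, A \<union> {k})\<close> if \<open>k \<notin> A\<close> and 0
  otherwise. Since the integral of \<open>exp (- t) exp (- (|B| - 1) t)\<close> over \<open>t \<ge> 0\<close> is \<open>1 / |B|\<close>, Parseval
  and Fubini show that the \<open>k\<close>-th term of the series has as its expectation the sum of
  \<open>c(F, B) c(G, B) / |B|\<close> over the finite \<open>B\<close> containing \<open>k\<close>. Summing over \<open>k\<close> gives the sum of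
  \<open>c(F, B) c(G, B)\<close> over the nonempty \<open>B\<close>, which is the covariance.
\<close>

section \<open>Square integrable functions\<close>

text \<open>Only two things are therefore extracted from such a family: its coefficients, which null
  sets cannot change, and the measurability that Fubini requires. That a family exists needs its own
  argument, since convergence in L2 at each t yields no joint measurability.

  The weight of Parseval lies in completeness of the \<open>Y_A\<close>: if all coefficients of an
  integrable function vanish, its positive and negative parts have equal integrals over every
  cylinder and so agree. Equality in Parseval then follows because the function rebuilt from the
  coefficients must be the given one.

  Two rearrangements need absolute convergence. The double sum over k and the sets B containing k
  has it, since products of square summable families are summable and each B is shared by |B|
  indices. Moving the sum over k inside the expectation rests on the gradient hypotheses: half the
  sum of the squared norms of \<open>D_k F\<close> and \<open>D_k G\<close> bounds the expected
  absolute value of the k-th term.\<close>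

lemma L2_measurable: "F \<in> L2 M \<Longrightarrow> F \<in> borel_measurable M"
  by (simp add: L2_def)

lemma L2_integrable_square: "F \<in> L2 M \<Longrightarrow> integrable M (\<lambda>\<omega>. (F \<omega>)\<^sup>2)"
  by (simp add: L2_def)

text \<open>A pointwise substitute for Cauchy-Schwarz, sufficient wherever only finiteness or a
  bound by a sum of squared norms is wanted.\<close>

lemma abs_mult_le_squares: "\<bar>a * b\<bar> \<le> (a\<^sup>2 + b\<^sup>2) / 2" for a b :: real
  using sum_squares_bound[of "\<bar>a\<bar>" "\<bar>b\<bar>"] by (simp add: abs_mult)

lemma L2_integrable_mult:
  assumes "F \<in> L2 M" "G \<in> L2 M"
  shows "integrable M (\<lambda>\<omega>. F \<omega> * G \<omega>)"
proof (rule Bochner_Integration.integrable_bound)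
  show "integrable M (\<lambda>\<omega>. ((F \<omega>)\<^sup>2 + (G \<omega>)\<^sup>2) / 2)"
    using assms by (auto simp: L2_def)
  show "(\<lambda>\<omega>. F \<omega> * G \<omega>) \<in> borel_measurable M"
    using assms by (auto simp: L2_def)
  show "AE \<omega> in M. norm (F \<omega> * G \<omega>) \<le> norm (((F \<omega>)\<^sup>2 + (G \<omega>)\<^sup>2) / 2)"
    using abs_mult_le_squares by (auto intro!: AE_I2)
qed

lemma L2_add:
  assumes "F \<in> L2 M" "G \<in> L2 M"
  shows "(\<lambda>\<omega>. F \<omega> + G \<omega>) \<in> L2 M"
proof -
  have "(\<lambda>\<omega>. (F \<omega> + G \<omega>)\<^sup>2) = (\<lambda>\<omega>. (F \<omega>)\<^sup>2 + (G \<omega>)\<^sup>2 + 2 * (F \<omega> * G \<omega>))"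
    by (auto simp: power2_eq_square algebra_simps)
  then show ?thesis
    using assms L2_integrable_mult[OF assms] by (auto simp: L2_def)
qed

lemma L2_cmult: "F \<in> L2 M \<Longrightarrow> (\<lambda>\<omega>. c * F \<omega>) \<in> L2 M" for c :: real
  by (auto simp: L2_def power_mult_distrib)

lemma L2_diff:
  assumes "F \<in> L2 M" "G \<in> L2 M"
  shows "(\<lambda>\<omega>. F \<omega> - G \<omega>) \<in> L2 M"
  using L2_add[OF assms(1) L2_cmult[OF assms(2), of "-1"]] by simp

lemma L2_sum: "(\<And>i. i \<in> I \<Longrightarrow> F i \<in> L2 M) \<Longrightarrow> (\<lambda>\<omega>. \<Sum>i\<in>I. F i \<omega>) \<in> L2 M"
proof (induction I rule: infinite_finite_induct)
  case (insert x I)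
  then show ?case by (auto intro: L2_add)
qed (auto simp: L2_def)

lemma L2_cong_AE:
  assumes "F \<in> L2 M" "G \<in> borel_measurable M" "AE \<omega> in M. F \<omega> = G \<omega>"
  shows "G \<in> L2 M"
proof -
  have "integrable M (\<lambda>\<omega>. (G \<omega>)\<^sup>2)"
    by (rule integrable_cong_AE_imp[OF L2_integrable_square[OF assms(1)]]) (use assms in auto)
  then show ?thesis using assms by (simp add: L2_def)
qed

lemma (in finite_measure) L2_integrable: "F \<in> L2 M \<Longrightarrow> integrable M F"
  using L2_integrable_mult[of F M "\<lambda>_. 1"] by (simp add: L2_def)

text \<open>The squared norm of F - s G is a quadratic in s that is never negative, so its
  discriminant is not positive.\<close>

lemma L2_Cauchy_Schwarz:
  assumes "F \<in> L2 M" "G \<in> L2 M"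
  shows "(\<integral>\<omega>. F \<omega> * G \<omega> \<partial>M)\<^sup>2 \<le> (\<integral>\<omega>. (F \<omega>)\<^sup>2 \<partial>M) * (\<integral>\<omega>. (G \<omega>)\<^sup>2 \<partial>M)"
proof -
  define a where "a = (\<integral>\<omega>. (F \<omega>)\<^sup>2 \<partial>M)"
  define b where "b = (\<integral>\<omega>. F \<omega> * G \<omega> \<partial>M)"
  define c where "c = (\<integral>\<omega>. (G \<omega>)\<^sup>2 \<partial>M)"
  have quad: "0 \<le> a - 2 * s * b + s\<^sup>2 * c" for s
  proof -
    have "(\<lambda>\<omega>. (F \<omega> - s * G \<omega>)\<^sup>2) =
        (\<lambda>\<omega>. (F \<omega>)\<^sup>2 - 2 * s * (F \<omega> * G \<omega>) + s\<^sup>2 * (G \<omega>)\<^sup>2)"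
      by (auto simp: power2_eq_square algebra_simps)
    moreover have "0 \<le> (\<integral>\<omega>. (F \<omega> - s * G \<omega>)\<^sup>2 \<partial>M)"
      by simp
    ultimately show ?thesis
      using L2_integrable_mult[OF assms] L2_integrable_square[OF assms(1)]
        L2_integrable_square[OF assms(2)]
      by (simp add: a_def b_def c_def)
  qed
  have "0 \<le> c" by (simp add: c_def)
  have "b\<^sup>2 \<le> a * c"
  proof (cases "c = 0")
    case True
    have "b = 0"
    proof (rule ccontr)
      assume "b \<noteq> 0"
      \<comment> \<open>With c = 0 the quadratic is affine in s, and this s gives it the value
        -1.\<close>
      then show False using quad[of "(a + 1) / (2 * b)"] True by simp
    qed
    then show ?thesis using True by simp
  next
    case False
    then have "c > 0" using \<open>0 \<le> c\<close> by simp
    have "0 \<le> a - b\<^sup>2 / c"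
      using quad[of "b / c"] False by (simp add: power2_eq_square)
    then show ?thesis using \<open>c > 0\<close> by (simp add: field_simps)
  qed
  then show ?thesis by (simp add: a_def b_def c_def)
qed

text \<open>Cauchy-Schwarz applied to S i - H and V. With V = \<open>Yprod p A\<close> it lets
  coefficients pass to L2 limits.\<close>

lemma L2_tendsto_inner:
  assumes S: "L2_tendsto M S H \<F>" and V: "V \<in> L2 M"
  shows "((\<lambda>i. \<integral>\<omega>. S i \<omega> * V \<omega> \<partial>M) \<longlongrightarrow> (\<integral>\<omega>. H \<omega> * V \<omega> \<partial>M)) \<F>"
proof -
  have H: "H \<in> L2 M" and ev: "\<forall>\<^sub>F i in \<F>. S i \<in> L2 M"
    and lim: "((\<lambda>i. \<integral>\<omega>. (S i \<omega> - H \<omega>)\<^sup>2 \<partial>M) \<longlongrightarrow> 0) \<F>"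
    using S by (auto simp: L2_tendsto_def)
  have "((\<lambda>i. sqrt ((\<integral>\<omega>. (S i \<omega> - H \<omega>)\<^sup>2 \<partial>M) * (\<integral>\<omega>. (V \<omega>)\<^sup>2 \<partial>M))) \<longlongrightarrow>
      sqrt (0 * (\<integral>\<omega>. (V \<omega>)\<^sup>2 \<partial>M))) \<F>"
    by (intro tendsto_intros lim)
  then have lim': "((\<lambda>i. sqrt ((\<integral>\<omega>. (S i \<omega> - H \<omega>)\<^sup>2 \<partial>M) * (\<integral>\<omega>. (V \<omega>)\<^sup>2 \<partial>M))) \<longlongrightarrow> 0) \<F>"
    by simp
  have "((\<lambda>i. (\<integral>\<omega>. S i \<omega> * V \<omega> \<partial>M) - (\<integral>\<omega>. H \<omega> * V \<omega> \<partial>M)) \<longlongrightarrow> 0) \<F>"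
  proof (rule Lim_null_comparison[OF _ lim'])
    show "\<forall>\<^sub>F i in \<F>. norm ((\<integral>\<omega>. S i \<omega> * V \<omega> \<partial>M) - (\<integral>\<omega>. H \<omega> * V \<omega> \<partial>M))
        \<le> sqrt ((\<integral>\<omega>. (S i \<omega> - H \<omega>)\<^sup>2 \<partial>M) * (\<integral>\<omega>. (V \<omega>)\<^sup>2 \<partial>M))"
      using ev
    proof eventually_elim
      case (elim i)
      have "(\<integral>\<omega>. S i \<omega> * V \<omega> \<partial>M) - (\<integral>\<omega>. H \<omega> * V \<omega> \<partial>M) =
          (\<integral>\<omega>. (S i \<omega> - H \<omega>) * V \<omega> \<partial>M)"
        using L2_integrable_mult[OF elim V] L2_integrable_mult[OF H V]
        by (simp add: left_diff_distrib)
      then show ?case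
        using L2_Cauchy_Schwarz[OF L2_diff[OF elim H] V] by (simp add: real_le_rsqrt)
    qed
  qed
  then show ?thesis by (simp add: Lim_null[symmetric])
qed

text \<open>|S|^2 = |S - H|^2 + 2 <S, H> - |H|^2, and continuity of the inner product handles the
  middle term.\<close>

lemma L2_tendsto_norm:
  assumes S: "L2_tendsto M S H \<F>"
  shows "((\<lambda>i. \<integral>\<omega>. (S i \<omega>)\<^sup>2 \<partial>M) \<longlongrightarrow> (\<integral>\<omega>. (H \<omega>)\<^sup>2 \<partial>M)) \<F>"
proof -
  have H: "H \<in> L2 M" and ev: "\<forall>\<^sub>F i in \<F>. S i \<in> L2 M"
    and lim: "((\<lambda>i. \<integral>\<omega>. (S i \<omega> - H \<omega>)\<^sup>2 \<partial>M) \<longlongrightarrow> 0) \<F>"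
    using S by (auto simp: L2_tendsto_def)
  have "((\<lambda>i. (\<integral>\<omega>. (S i \<omega> - H \<omega>)\<^sup>2 \<partial>M) + 2 * (\<integral>\<omega>. S i \<omega> * H \<omega> \<partial>M) - (\<integral>\<omega>. (H \<omega>)\<^sup>2 \<partial>M)) \<longlongrightarrow>
      0 + 2 * (\<integral>\<omega>. H \<omega> * H \<omega> \<partial>M) - (\<integral>\<omega>. (H \<omega>)\<^sup>2 \<partial>M)) \<F>"
    by (intro tendsto_intros lim L2_tendsto_inner[OF S H])
  moreover have "\<forall>\<^sub>F i in \<F>. (\<integral>\<omega>. (S i \<omega> - H \<omega>)\<^sup>2 \<partial>M) + 2 * (\<integral>\<omega>. S i \<omega> * H \<omega> \<partial>M) - (\<integral>\<omega>. (H \<omega>)\<^sup>2 \<partial>M)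
      = (\<integral>\<omega>. (S i \<omega>)\<^sup>2 \<partial>M)"
    using ev
  proof eventually_elim
    case (elim i)
    have "(\<lambda>\<omega>. (S i \<omega> - H \<omega>)\<^sup>2) = (\<lambda>\<omega>. (S i \<omega>)\<^sup>2 - 2 * (S i \<omega> * H \<omega>) + (H \<omega>)\<^sup>2)"
      by (auto simp: power2_eq_square algebra_simps)
    then show ?case
      using L2_integrable_mult[OF elim H] L2_integrable_square[OF H] L2_integrable_square[OF elim]
      by simp
  qed
  ultimately show ?thesis
    by (auto simp: power2_eq_square[of "H _"] intro: Lim_transform_eventually)
qed

text \<open>The sum of the norms has finite integral by monotone convergence, so it is finite almost
  everywhere. This supplies the pointwise hypothesis for integrating a series term by term.\<close>

lemma AE_summable_norm:
  fixes f :: "nat \<Rightarrow> 'a \<Rightarrow> real"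
  assumes f: "\<And>n. integrable M (f n)" and sum: "summable (\<lambda>n. \<integral>\<omega>. norm (f n \<omega>) \<partial>M)"
  shows "AE \<omega> in M. summable (\<lambda>n. norm (f n \<omega>))"
proof -
  have [measurable]: "f n \<in> borel_measurable M" for n
    using f by simp
  have "(\<integral>\<^sup>+\<omega>. (\<Sum>n. ennreal (norm (f n \<omega>))) \<partial>M) = (\<Sum>n. \<integral>\<^sup>+\<omega>. ennreal (norm (f n \<omega>)) \<partial>M)"
    by (intro nn_integral_suminf) auto
  also have "\<dots> = (\<Sum>n. ennreal (\<integral>\<omega>. norm (f n \<omega>) \<partial>M))"
    using f by (simp add: nn_integral_eq_integral)
  also have "\<dots> \<noteq> \<infinity>"
    using sum by (simp add: ennreal_suminf_neq_top)
  finally have "AE \<omega> in M. (\<Sum>n. ennreal (norm (f n \<omega>))) \<noteq> \<infinity>"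
    by (intro nn_integral_noteq_infinite) auto
  then show ?thesis
    by eventually_elim (auto intro: summable_suminf_not_top)
qed

text \<open>
  A rapidly Cauchy subsequence converges almost everywhere because its increments are summable
  in \<open>L\<^sup>1\<close>; Fatou's lemma identifies its pointwise limit as the \<open>L\<^sup>2\<close> limit.
\<close>

lemma (in finite_measure) L2_complete:
  assumes S: "\<And>n. S n \<in> L2 M"
    and Cauchy: "\<And>e. e > 0 \<Longrightarrow> \<exists>N. \<forall>m\<ge>N. \<forall>n\<ge>N. (\<integral>\<omega>. (S m \<omega> - S n \<omega>)\<^sup>2 \<partial>M) < e"
  obtains H where "L2_tendsto M S H sequentially"
proof -
  have [measurable]: "S n \<in> borel_measurable M" for n
    using S by (rule L2_measurable)
  have "\<forall>k. \<exists>N. \<forall>m\<ge>N. \<forall>n\<ge>N. (\<integral>\<omega>. (S m \<omega> - S n \<omega>)\<^sup>2 \<partial>M) < (1 / 4) ^ k"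
    using Cauchy by simp
  then obtain r0 where r0: "\<And>k m n. m \<ge> r0 k \<Longrightarrow> n \<ge> r0 k \<Longrightarrow>
      (\<integral>\<omega>. (S m \<omega> - S n \<omega>)\<^sup>2 \<partial>M) < (1 / 4) ^ k"
    by metis
  \<comment> \<open>Summing the earlier thresholds puts both \<open>r k\<close> and
    \<open>r (Suc k)\<close> beyond \<open>r0 k\<close>; the summand k gives
    \<open>r j \<ge> j\<close>, which the Fatou estimate uses.\<close>
  define r where "r k = (\<Sum>j\<le>k. r0 j) + k" for k
  have r_ge: "r0 k \<le> r k" for k
    using member_le_sum[of k "{..k}" r0] by (simp add: r_def)
  have r_Suc: "r0 k \<le> r (Suc k)" for k
    using member_le_sum[of k "{..Suc k}" r0] by (simp add: r_def)
  define d where "d k \<omega> = S (r (Suc k)) \<omega> - S (r k) \<omega>" for k \<omega>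
  have [measurable]: "d k \<in> borel_measurable M" for k
    unfolding d_def by measurable
  have d: "d k \<in> L2 M" for k
    unfolding d_def by (intro L2_diff S)
  have int_d: "integrable M (d k)" for k
    by (rule L2_integrable[OF d])
  have norm_d: "(\<integral>\<omega>. norm (d k \<omega>) \<partial>M) \<le> (measure M (space M) + 1) * (1 / 2) ^ k" for k
  proof -
    \<comment> \<open>Arithmetic-geometric mean with weight 2^k: against the rate (1/4)^k of the
      squared increments it leaves the summable (1/2)^k.\<close>
    have "norm (d k \<omega>) \<le> (1 / 2) ^ k + 2 ^ k * (d k \<omega>)\<^sup>2" for \<omega>
    proof -
      have "\<bar>(1 / 2) ^ k * (2 ^ k * d k \<omega>)\<bar> \<le> 2 ^ k * (((1 / 2) ^ k)\<^sup>2 + (d k \<omega>)\<^sup>2)"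
        using mult_left_mono[OF abs_mult_le_squares[of "(1/2)^k" "d k \<omega>"], of "2^k"]
          zero_le_power2[of "(1/2::real)^k"] zero_le_power2[of "d k \<omega>"]
        by (simp add: abs_mult) (smt (verit) field_sum_of_halves mult_left_mono zero_le_power)
      also have "\<dots> = (1 / 2) ^ k + 2 ^ k * (d k \<omega>)\<^sup>2"
        by (simp add: power2_eq_square field_simps power_divide)
      finally show ?thesis
        by (simp add: power_divide)
    qed
    then have "(\<integral>\<omega>. norm (d k \<omega>) \<partial>M) \<le> (\<integral>\<omega>. (1 / 2) ^ k + 2 ^ k * (d k \<omega>)\<^sup>2 \<partial>M)"
      using int_d L2_integrable_square[OF d] by (intro integral_mono) auto
    also have "\<dots> = measure M (space M) * (1 / 2) ^ k + 2 ^ k * (\<integral>\<omega>. (d k \<omega>)\<^sup>2 \<partial>M)"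
      using L2_integrable_square[OF d] by simp
    also have "(\<integral>\<omega>. (d k \<omega>)\<^sup>2 \<partial>M) \<le> (1 / 4) ^ k"
      unfolding d_def using r0[OF r_Suc r_ge] by (simp add: less_imp_le)
    also have "2 ^ k * (1 / 4) ^ k = (1 / 2 :: real) ^ k"
      by (simp add: power_mult_distrib[symmetric])
    finally show ?thesis by (simp add: algebra_simps)
  qed
  have sum_d: "summable (\<lambda>k. \<integral>\<omega>. norm (d k \<omega>) \<partial>M)"
    by (rule summable_comparison_test'[where g = "\<lambda>k. (measure M (space M) + 1) * (1 / 2) ^ k"])
      (use norm_d in \<open>auto intro!: summable_mult summable_geometric\<close>)
  have AE_d: "AE \<omega> in M. summable (\<lambda>k. norm (d k \<omega>))"
    by (rule AE_summable_norm[OF int_d sum_d])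
  define H where "H \<omega> = lim (\<lambda>k. S (r k) \<omega>)" for \<omega>
  have H[measurable]: "H \<in> borel_measurable M"
    unfolding H_def by measurable
  have AE_H: "AE \<omega> in M. (\<lambda>k. S (r k) \<omega>) \<longlonglongrightarrow> H \<omega>"
    using AE_d
  proof eventually_elim
    case (elim \<omega>)
    then have "summable (\<lambda>k. d k \<omega>)"
      by (rule summable_norm_cancel)
    then have "convergent (\<lambda>k. \<Sum>j<k. d j \<omega>)"
      by (simp add: summable_iff_convergent)
    then have "convergent (\<lambda>k. (\<Sum>j<k. d j \<omega>) + S (r 0) \<omega>)"
      by (intro convergent_add convergent_const)
    moreover have "(\<Sum>j<k. d j \<omega>) + S (r 0) \<omega> = S (r k) \<omega>" for k
      using sum_lessThan_telescope[of "\<lambda>k. S (r k) \<omega>" k] by (simp add: d_def)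
    ultimately show ?case
      unfolding H_def by (simp add: convergent_LIMSEQ_iff)
  qed
  have Fatou: "(\<integral>\<^sup>+\<omega>. ennreal ((S n \<omega> - H \<omega>)\<^sup>2) \<partial>M) \<le> ennreal ((1 / 4) ^ k)" if n: "n \<ge> r0 k" for n k
  proof -
    have "(\<integral>\<^sup>+\<omega>. ennreal ((S n \<omega> - H \<omega>)\<^sup>2) \<partial>M)
        = (\<integral>\<^sup>+\<omega>. liminf (\<lambda>j. ennreal ((S n \<omega> - S (r j) \<omega>)\<^sup>2)) \<partial>M)"
    proof (rule nn_integral_cong_AE, use AE_H in eventually_elim)
      case (elim \<omega>)
      have "(\<lambda>j. ennreal ((S n \<omega> - S (r j) \<omega>)\<^sup>2)) \<longlonglongrightarrow> ennreal ((S n \<omega> - H \<omega>)\<^sup>2)"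
        by (intro tendsto_intros elim)
      then have "liminf (\<lambda>j. ennreal ((S n \<omega> - S (r j) \<omega>)\<^sup>2)) = ennreal ((S n \<omega> - H \<omega>)\<^sup>2)"
        by (intro lim_imp_Liminf) auto
      then show ?case by simp
    qed
    also have "\<dots> \<le> liminf (\<lambda>j. \<integral>\<^sup>+\<omega>. ennreal ((S n \<omega> - S (r j) \<omega>)\<^sup>2) \<partial>M)"
      by (intro nn_integral_liminf) auto
    also have "\<dots> \<le> ennreal ((1 / 4) ^ k)"
    proof (rule Liminf_le)
      show "\<forall>\<^sub>F j in sequentially. (\<integral>\<^sup>+\<omega>. ennreal ((S n \<omega> - S (r j) \<omega>)\<^sup>2) \<partial>M) \<le> ennreal ((1 / 4) ^ k)"
        using eventually_ge_at_top[of "r0 k"]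
      proof eventually_elim
        case (elim j)
        have "r0 k \<le> r j"
          using elim by (simp add: r_def)
        then show ?case
          using r0[OF n \<open>r0 k \<le> r j\<close>] L2_integrable_square[OF L2_diff[OF S S]]
          by (subst nn_integral_eq_integral) (auto intro!: ennreal_leI)
      qed
    qed simp
    finally show ?thesis .
  qed
  have diff: "(\<lambda>\<omega>. S n \<omega> - H \<omega>) \<in> L2 M" if "n \<ge> r0 k" for n k
  proof -
    have "integrable M (\<lambda>\<omega>. (S n \<omega> - H \<omega>)\<^sup>2)"
      by (rule integrableI_bounded)
        (use Fatou[OF that] in \<open>auto simp: order_le_less_trans[OF _ ennreal_less_top]\<close>)
    then show ?thesis by (simp add: L2_def)
  qed
  have HL2: "H \<in> L2 M"
    using L2_diff[OF S[of "r0 0"] diff[of 0 "r0 0"]] by simp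
  have "(\<lambda>n. \<integral>\<omega>. (S n \<omega> - H \<omega>)\<^sup>2 \<partial>M) \<longlonglongrightarrow> 0"
  proof (rule LIMSEQ_I)
    fix e :: real assume "0 < e"
    then obtain k where k: "(1 / 4) ^ k < e"
      using real_arch_pow_inv[of e "1/4"] by auto
    have "norm ((\<integral>\<omega>. (S n \<omega> - H \<omega>)\<^sup>2 \<partial>M) - 0) < e" if "n \<ge> r0 k" for n
    proof -
      have "ennreal (\<integral>\<omega>. (S n \<omega> - H \<omega>)\<^sup>2 \<partial>M) \<le> ennreal ((1 / 4) ^ k)"
        using Fatou[OF that] L2_integrable_square[OF diff[OF that]]
        by (simp add: nn_integral_eq_integral)
      then show ?thesis using k by simp
    qed
    then show "\<exists>no. \<forall>n\<ge>no. norm ((\<integral>\<omega>. (S n \<omega> - H \<omega>)\<^sup>2 \<partial>M) - 0) < e"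
      by blast
  qed
  then have "L2_tendsto M S H sequentially"
    using S HL2 by (simp add: L2_tendsto_def)
  then show thesis by (rule that)
qed

section \<open>The orthonormal system of products\<close>

text \<open>The Walsh functions of the biased cube. Sets list each product of n factors once,
  multi-indices list it n! times. For infinite A the product is 1 by convention, hence the
  finiteness side conditions throughout.\<close>

definition Yprod :: "(nat \<Rightarrow> real) \<Rightarrow> nat set \<Rightarrow> (nat \<Rightarrow> real) \<Rightarrow> real" where
  "Yprod p A \<omega> = (\<Prod>k\<in>A. Y p k \<omega>)"

definition coef :: "(nat \<Rightarrow> real) \<Rightarrow> ((nat \<Rightarrow> real) \<Rightarrow> real) \<Rightarrow> nat set \<Rightarrow> real" where
  "coef p F A = (\<integral>\<omega>. F \<omega> * Yprod p A \<omega> \<partial>rademacher p)"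

lemma Yprod_empty [simp]: "Yprod p {} \<omega> = 1"
  by (simp add: Yprod_def)

lemma Yprod_insert: "finite A \<Longrightarrow> k \<notin> A \<Longrightarrow> Yprod p (insert k A) \<omega> = Y p k \<omega> * Yprod p A \<omega>"
  by (simp add: Yprod_def)

lemma coef_zero: "coef p (\<lambda>_. 0) A = 0"
  by (simp add: coef_def)

lemma Y_upd_other: "j \<noteq> k \<Longrightarrow> Y p j (\<omega> (k := x)) = Y p j \<omega>"
  by (simp add: Y_def)

lemma Yprod_upd: "k \<notin> A \<Longrightarrow> Yprod p A (\<omega> (k := x)) = Yprod p A \<omega>"
  unfolding Yprod_def by (intro prod.cong refl Y_upd_other) auto

section \<open>The product measure and averaging over a single coordinate\<close>

locale rademacher_product =
  fixes p :: "nat \<Rightarrow> real"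
  assumes p: "\<And>k. 0 < p k \<and> p k < 1"
begin

abbreviation "M \<equiv> rademacher p"

abbreviation coin :: "nat \<Rightarrow> real measure" where
  "coin k \<equiv> point_measure {-1, 1} (\<lambda>x. ennreal (if x = 1 then p k else 1 - p k))"

abbreviation \<sigma> :: "nat \<Rightarrow> real" where
  "\<sigma> k \<equiv> sqrt (p k * (1 - p k))"

lemma \<sigma>_pos: "0 < \<sigma> k"
  using p[of k] by simp

lemma \<sigma>_square: "\<sigma> k * \<sigma> k = p k * (1 - p k)"
  using p[of k] by simp

lemma prob_space_coin: "prob_space (coin k)"
proof (rule prob_space_point_measure)
  have "ennreal (1 - p k) + ennreal (p k) = ennreal 1"
    using p[of k] by (subst ennreal_plus[symmetric]) auto
  then show "(\<Sum>s\<in>{-1, 1::real}. ennreal (if s = 1 then p k else 1 - p k)) = 1"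
    by simp
qed auto

lemma rademacher_eq: "M = PiM UNIV coin"
  by (simp add: rademacher_def)

sublocale prob_space "rademacher p"
  unfolding rademacher_def by (intro prob_space_PiM prob_space_coin)

lemma space_rademacher: "space M = {\<omega>. \<forall>k. \<omega> k = 1 \<or> \<omega> k = -1}"
  unfolding rademacher_def by (auto simp: space_PiM space_point_measure PiE_def Pi_def)

lemma measurable_component [measurable]: "(\<lambda>\<omega>. \<omega> k) \<in> borel_measurable M"
proof -
  have "(\<lambda>\<omega>. \<omega> k) \<in> measurable M (coin k)"
    unfolding rademacher_eq by (rule measurable_component_singleton) simp
  moreover have "(\<lambda>x. x) \<in> borel_measurable (coin k)"
    by simp
  ultimately show ?thesis
    by (rule measurable_compose)
qed

lemma measurable_upd:
  assumes "x = 1 \<or> x = -1"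
  shows "(\<lambda>\<omega>. \<omega> (k := x)) \<in> measurable M M"
  unfolding rademacher_eq
  by (rule measurable_fun_upd[where J = UNIV]) (use assms in \<open>auto simp: space_point_measure\<close>)

lemma measurable_Yprod [measurable]: "Yprod p A \<in> borel_measurable M"
  unfolding Yprod_def Y_def by measurable

text \<open>Resampling the k-th coordinate by an independent coin leaves the product measure
  invariant: M is the image of the product of \<open>coin k\<close> and M under the update. Fubini
  then integrates out the coin.\<close>

lemma
  fixes f :: "(nat \<Rightarrow> real) \<Rightarrow> real"
  assumes f: "integrable M f"
  shows integrable_upd: "x = 1 \<or> x = -1 \<Longrightarrow> integrable M (\<lambda>\<omega>. f (\<omega> (k := x)))"
    and integral_split: "(\<integral>\<omega>. f \<omega> \<partial>M) =
      (\<integral>\<omega>. p k * f (\<omega> (k := 1)) + (1 - p k) * f (\<omega> (k := -1)) \<partial>M)"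
proof -
  interpret C: prob_space "coin k" by (rule prob_space_coin)
  interpret pair_sigma_finite "coin k" M ..
  have upd: "(\<lambda>(x, \<omega>). \<omega> (k := x)) \<in> measurable (coin k \<Otimes>\<^sub>M M) M"
    unfolding rademacher_eq case_prod_beta
    by (rule measurable_fun_upd[where J = UNIV]) auto
  have distr: "distr (coin k \<Otimes>\<^sub>M M) M (\<lambda>(x, \<omega>). \<omega> (k := x)) = M"
    using distr_pair_PiM_eq_PiM[of UNIV coin k] prob_space_coin by (simp add: rademacher_eq)
  have int: "integrable (coin k \<Otimes>\<^sub>M M) (\<lambda>(x, \<omega>). f (\<omega> (k := x)))"
    using integrable_distr[OF upd, unfolded distr, OF f] by (simp add: case_prod_unfold)
  have "AE x in coin k. integrable M (\<lambda>\<omega>. f (\<omega> (k := x)))"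
    using AE_integrable_fst'[OF int] by simp
  \<comment> \<open>Both outcomes have positive mass, so what holds almost surely under
    \<open>coin k\<close> holds for 1 and for -1.\<close>
  then have upd_int: "integrable M (\<lambda>\<omega>. f (\<omega> (k := x)))" if "x = 1 \<or> x = -1" for x
    using that p[of k] by (auto simp: AE_point_measure)
  then show "x = 1 \<or> x = -1 \<Longrightarrow> integrable M (\<lambda>\<omega>. f (\<omega> (k := x)))" .
  have "(\<integral>\<omega>. f \<omega> \<partial>M) = (\<integral>z. (\<lambda>(x, \<omega>). f (\<omega> (k := x))) z \<partial>(coin k \<Otimes>\<^sub>M M))"
    using integral_distr[OF upd borel_measurable_integrable[OF f], unfolded distr]
    by (simp only: case_prod_unfold)
  also have "\<dots> = (\<integral>x. (\<integral>\<omega>. f (\<omega> (k := x)) \<partial>M) \<partial>coin k)"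
    using integral_fst'[OF int] by simp
  also have "\<dots> = p k * (\<integral>\<omega>. f (\<omega> (k := 1)) \<partial>M) + (1 - p k) * (\<integral>\<omega>. f (\<omega> (k := -1)) \<partial>M)"
    using p[of k] by (subst lebesgue_integral_point_measure_finite) auto
  finally show "(\<integral>\<omega>. f \<omega> \<partial>M) = (\<integral>\<omega>. p k * f (\<omega> (k := 1)) + (1 - p k) * f (\<omega> (k := -1)) \<partial>M)"
    using upd_int by simp
qed

lemma Y_upd_same: "Y p k (\<omega> (k := 1)) = (1 - p k) / \<sigma> k" "Y p k (\<omega> (k := -1)) = - p k / \<sigma> k"
proof -
  have "(1 - p k - p k + 1) / (2 * s) = (1 - p k) / s" "(1 - p k - p k + - 1) / (2 * s) = - p k / s"
    for s :: real
    by (cases "s = 0"; simp add: field_simps)+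
  then show "Y p k (\<omega> (k := 1)) = (1 - p k) / \<sigma> k" "Y p k (\<omega> (k := -1)) = - p k / \<sigma> k"
    by (simp_all only: Y_def fun_upd_same)
qed

text \<open>Probability times value of \<open>Y p k\<close> is plus or minus
  \<open>\<sigma> k\<close>, the very factor in front of \<open>D\<close>; integration by parts
  rests on this cancellation.\<close>

lemma p_mult_Y: "p k * Y p k (\<omega> (k := 1)) = \<sigma> k" "(1 - p k) * Y p k (\<omega> (k := -1)) = - \<sigma> k"
  using \<sigma>_pos[of k] \<sigma>_square[of k] unfolding Y_upd_same by (auto simp: divide_simps)

lemma Yprod_bounded:
  assumes "finite A"
  shows "\<exists>C. \<forall>\<omega>\<in>space M. \<bar>Yprod p A \<omega>\<bar> \<le> C"
proof (intro exI ballI)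
  fix \<omega> assume \<omega>: "\<omega> \<in> space M"
  have "\<bar>Y p k \<omega>\<bar> \<le> 1 / \<sigma> k" for k
  proof -
    have "\<omega> k = 1 \<or> \<omega> k = -1"
      using \<omega> by (simp add: space_rademacher)
    then have "\<bar>1 - p k - p k + \<omega> k\<bar> \<le> 2"
      using p[of k] by auto
    then show ?thesis
      using \<sigma>_pos[of k] unfolding Y_def by (simp add: abs_divide divide_simps)
  qed
  then show "\<bar>Yprod p A \<omega>\<bar> \<le> (\<Prod>k\<in>A. 1 / \<sigma> k)"
    unfolding Yprod_def abs_prod by (intro prod_mono) auto
qed

text \<open>\<open>Yprod p A\<close> is bounded on the sample space, so coefficients make sense for
  functions whose square integrability is not yet known.\<close>

lemma integrable_mult_Yprod:
  assumes "integrable M f" "finite A"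
  shows "integrable M (\<lambda>\<omega>. f \<omega> * Yprod p A \<omega>)"
proof -
  obtain C where C: "\<And>\<omega>. \<omega> \<in> space M \<Longrightarrow> \<bar>Yprod p A \<omega>\<bar> \<le> C"
    using Yprod_bounded[OF assms(2)] by blast
  show ?thesis
  proof (rule Bochner_Integration.integrable_bound)
    show "integrable M (\<lambda>\<omega>. C * f \<omega>)"
      using assms by simp
    show "AE \<omega> in M. norm (f \<omega> * Yprod p A \<omega>) \<le> norm (C * f \<omega>)"
    proof (rule AE_I2)
      fix \<omega> assume "\<omega> \<in> space M"
      then have "\<bar>Yprod p A \<omega>\<bar> \<le> \<bar>C\<bar>" using C[of \<omega>] by simp
      then show "norm (f \<omega> * Yprod p A \<omega>) \<le> norm (C * f \<omega>)"
        by (simp add: abs_mult mult.commute[of "\<bar>C\<bar>"] mult_left_mono)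
    qed
  qed (use assms in measurable)
qed

section \<open>Difference operators and orthonormality\<close>

lemma Yprod_L2:
  assumes "finite A"
  shows "Yprod p A \<in> L2 M"
proof -
  have "integrable M (\<lambda>\<omega>. 1 * Yprod p A \<omega> * Yprod p A \<omega>)"
    by (intro integrable_mult_Yprod assms) auto
  then show ?thesis by (simp add: L2_def power2_eq_square)
qed

lemma integrable_D: "integrable M f \<Longrightarrow> integrable M (D p k f)"
  unfolding D_def by (simp add: integrable_upd)

lemma D_L2:
  assumes "f \<in> L2 M"
  shows "D p k f \<in> L2 M"
proof -
  have "(\<lambda>\<omega>. f (\<omega> (k := x))) \<in> L2 M" if "x = 1 \<or> x = -1" for x
    using that integrable_upd[OF L2_integrable_square[OF assms]]
      measurable_compose[OF measurable_upd L2_measurable[OF assms]]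
    by (auto simp: L2_def)
  then show ?thesis
    unfolding D_def by (intro L2_cmult L2_diff) auto
qed

text \<open>
  Integration by parts: averaging over the \<open>k\<close>-th coordinate turns multiplication by \<open>Y\<^sub>k\<close>
  into the difference operator \<open>D\<^sub>k\<close>.
\<close>

lemma coef_insert:
  assumes f: "integrable M f" and "finite A" "k \<notin> A"
  shows "coef p f (insert k A) = coef p (D p k f) A"
proof -
  have "coef p f (insert k A) = (\<integral>\<omega>. p k * (f (\<omega> (k := 1)) * Yprod p (insert k A) (\<omega> (k := 1)))
      + (1 - p k) * (f (\<omega> (k := -1)) * Yprod p (insert k A) (\<omega> (k := -1))) \<partial>M)"
    unfolding coef_def
    by (rule integral_split) (use assms in \<open>auto intro!: integrable_mult_Yprod\<close>)
  also have "(\<lambda>\<omega>. p k * (f (\<omega> (k := 1)) * Yprod p (insert k A) (\<omega> (k := 1)))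
      + (1 - p k) * (f (\<omega> (k := -1)) * Yprod p (insert k A) (\<omega> (k := -1))))
      = (\<lambda>\<omega>. D p k f \<omega> * Yprod p A \<omega>)"
  proof
    fix \<omega>
    have "p k * (f (\<omega> (k := 1)) * Yprod p (insert k A) (\<omega> (k := 1)))
      + (1 - p k) * (f (\<omega> (k := -1)) * Yprod p (insert k A) (\<omega> (k := -1)))
      = (p k * Y p k (\<omega> (k := 1))) * f (\<omega> (k := 1)) * Yprod p A \<omega>
      + ((1 - p k) * Y p k (\<omega> (k := -1))) * f (\<omega> (k := -1)) * Yprod p A \<omega>"
      using assms by (simp add: Yprod_insert Yprod_upd mult_ac)
    then show "p k * (f (\<omega> (k := 1)) * Yprod p (insert k A) (\<omega> (k := 1)))
      + (1 - p k) * (f (\<omega> (k := -1)) * Yprod p (insert k A) (\<omega> (k := -1)))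
      = D p k f \<omega> * Yprod p A \<omega>"
      unfolding p_mult_Y by (simp add: D_def algebra_simps)
  qed
  finally show ?thesis by (simp add: coef_def)
qed

text \<open>\<open>D p k f\<close> does not depend on the k-th coordinate, so a second
  \<open>D p k\<close>, which integration by parts produces, annihilates it.\<close>

lemma coef_D_mem:
  assumes "integrable M f" "finite A" "k \<in> A"
  shows "coef p (D p k f) A = 0"
proof -
  have "coef p (D p k f) (insert k (A - {k})) = coef p (D p k (D p k f)) (A - {k})"
    using assms by (intro coef_insert integrable_D) auto
  also have "D p k (D p k f) = (\<lambda>\<omega>. 0)"
    by (rule ext) (simp add: D_def)
  finally show ?thesis
    using assms by (simp add: insert_absorb coef_def)
qed

text \<open>The jump of \<open>Y p k\<close> between the two outcomes is
  \<open>1 / \<sigma> k\<close>, so \<open>D p k\<close> acts as a derivative and strikes out the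
  factor with index k.\<close>

lemma D_Yprod:
  assumes "finite B"
  shows "D p k (Yprod p B) = (if k \<in> B then Yprod p (B - {k}) else (\<lambda>_. 0))"
proof (cases "k \<in> B")
  case True
  have eq: "Yprod p B \<omega> = Y p k \<omega> * Yprod p (B - {k}) \<omega>" for \<omega>
    using assms True Yprod_insert[of "B - {k}" k p \<omega>] by (simp add: insert_absorb)
  have "\<sigma> k * (Y p k (\<omega> (k := 1)) - Y p k (\<omega> (k := -1))) = 1" for \<omega>
    using p[of k] by (simp add: Y_upd_same add_divide_distrib[symmetric])
  then have "\<sigma> k * (Y p k (\<omega> (k := 1)) * z - Y p k (\<omega> (k := -1)) * z) = z" for \<omega> z
    by (simp add: left_diff_distrib[symmetric] mult.assoc[symmetric])
  then show ?thesis
    using True by (auto simp: D_def eq Yprod_upd)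
next
  case False
  then show ?thesis by (simp add: fun_eq_iff D_def Yprod_upd)
qed

text \<open>Integration by parts removes one index from both sets at a time, or yields 0 if B lacks
  that index.\<close>

lemma coef_Yprod:
  assumes "finite A" "finite B"
  shows "coef p (Yprod p B) A = (if A = B then 1 else 0)"
  using assms
proof (induction A arbitrary: B rule: finite_induct)
  case empty
  show ?case
  proof (cases "B = {}")
    case True
    then show ?thesis by (simp add: coef_def prob_space)
  next
    case False
    then obtain k where k: "k \<in> B" by blast
    \<comment> \<open>The factors change roles: the constant 1 is differentiated and
      \<open>Yprod p B\<close> becomes the test function.\<close>
    have "coef p (Yprod p B) {} = coef p (Yprod p {}) (insert k (B - {k}))"
      using k by (simp add: coef_def insert_absorb)
    also have "\<dots> = coef p (D p k (Yprod p {})) (B - {k})"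
      using empty by (intro coef_insert L2_integrable Yprod_L2) auto
    also have "\<dots> = 0"
      by (simp add: D_Yprod coef_def)
    finally show ?thesis using False by simp
  qed
next
  case (insert k A)
  have "coef p (Yprod p B) (insert k A) = coef p (D p k (Yprod p B)) A"
    using insert by (intro coef_insert L2_integrable Yprod_L2) auto
  also have "\<dots> = (if k \<in> B \<and> A = B - {k} then 1 else 0)"
    using insert.IH[of "B - {k}"] insert.prems by (auto simp: D_Yprod coef_zero)
  also have "\<dots> = (if insert k A = B then 1 else 0)"
    using insert by auto
  finally show ?case .
qed

text \<open>
  On the sample space every indicator function of a coordinate is affine in \<open>Y\<^sub>k\<close>, so indicators
  of cylinder sets are linear combinations of the products \<open>Y\<^sub>A\<close>.
\<close>

lemma coef_eq_0_imp_integral_cylinder: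
  assumes H: "integrable M H" and coef: "\<And>A. finite A \<Longrightarrow> coef p H A = 0"
    and J: "finite J" and E: "\<And>j. j \<in> J \<Longrightarrow> E j \<in> sets (coin j)"
  shows "(\<integral>\<omega>. H \<omega> * indicator (prod_emb UNIV coin J (Pi\<^sub>E J E)) \<omega> \<partial>M) = 0"
proof -
  \<comment> \<open>\<open>a j\<close> is the mean of the indicator of \<open>E j\<close> under the
    coin and \<open>b j\<close> its coefficient against \<open>Y p j\<close>, so
    \<open>a j + b j * Y p j\<close> reproduces the indicator at both outcomes.\<close>
  define a where "a j = p j * indicator (E j) 1 + (1 - p j) * indicator (E j) (-1)" for j
  define b where "b j = \<sigma> j * (indicator (E j) 1 - indicator (E j) (-1))" for j
  have "(indicator (prod_emb UNIV coin J (Pi\<^sub>E J E)) \<omega> :: real) =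
      (\<Sum>A\<in>Pow J. ((\<Prod>j\<in>A. b j) * (\<Prod>j\<in>J - A. a j)) * Yprod p A \<omega>)" if \<omega>: "\<omega> \<in> space M" for \<omega>
  proof -
    have "(indicator (prod_emb UNIV coin J (Pi\<^sub>E J E)) \<omega> :: real) = (\<Prod>j\<in>J. indicator (E j) (\<omega> j))"
      using \<omega> J unfolding rademacher_eq
      by (auto simp: prod_emb_iff indicator_def space_PiM PiE_iff restrict_def extensional_def)
    also have "\<dots> = (\<Prod>j\<in>J. b j * Y p j \<omega> + a j)"
    proof (rule prod.cong[OF refl])
      fix j assume "j \<in> J"
      have "\<omega> j = 1 \<or> \<omega> j = -1" using \<omega> by (simp add: space_rademacher)
      then have "\<sigma> j * Y p j \<omega> = (if \<omega> j = 1 then 1 - p j else - p j)"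
        using \<sigma>_pos[of j] by (auto simp: Y_def)
      moreover have "b j * Y p j \<omega> = (indicator (E j) 1 - indicator (E j) (-1)) * (\<sigma> j * Y p j \<omega>)"
        unfolding b_def by (simp only: mult_ac)
      ultimately have "b j * Y p j \<omega> =
          (indicator (E j) 1 - indicator (E j) (-1)) * (if \<omega> j = 1 then 1 - p j else - p j)"
        by simp
      then show "indicator (E j) (\<omega> j) = b j * Y p j \<omega> + a j"
        using \<open>\<omega> j = 1 \<or> \<omega> j = -1\<close> by (auto simp: a_def algebra_simps)
    qed
    also have "\<dots> = (\<Sum>A\<in>Pow J. (\<Prod>j\<in>A. b j * Y p j \<omega>) * (\<Prod>j\<in>J - A. a j))"
      by (rule prod_add[OF J])
    also have "\<dots> = (\<Sum>A\<in>Pow J. ((\<Prod>j\<in>A. b j) * (\<Prod>j\<in>J - A. a j)) * Yprod p A \<omega>)"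
      by (simp add: prod.distrib Yprod_def mult_ac)
    finally show ?thesis .
  qed
  then have "(\<integral>\<omega>. H \<omega> * indicator (prod_emb UNIV coin J (Pi\<^sub>E J E)) \<omega> \<partial>M) =
      (\<integral>\<omega>. (\<Sum>A\<in>Pow J. ((\<Prod>j\<in>A. b j) * (\<Prod>j\<in>J - A. a j)) * (H \<omega> * Yprod p A \<omega>)) \<partial>M)"
    by (intro Bochner_Integration.integral_cong) (auto simp: sum_distrib_left mult_ac)
  also have "\<dots> = (\<Sum>A\<in>Pow J. ((\<Prod>j\<in>A. b j) * (\<Prod>j\<in>J - A. a j)) * coef p H A)"
    unfolding coef_def using J H
    by (subst Bochner_Integration.integral_sum)
      (auto intro!: integrable_mult_right integrable_mult_Yprod intro: finite_subset)
  also have "\<dots> = 0"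
  proof (intro sum.neutral ballI)
    fix A assume "A \<in> Pow J"
    then have "finite A" using J finite_subset by auto
    then show "(\<Prod>j\<in>A. b j) * (\<Prod>j\<in>J - A. a j) * coef p H A = 0"
      by (simp add: coef)
  qed
  finally show ?thesis .
qed

text \<open>The positive and negative parts of H are densities of two finite measures that agree on
  cylinders, hence everywhere, and densities are unique almost everywhere.\<close>

theorem coef_eq_0_imp_AE_0:
  assumes H: "integrable M H" and coef: "\<And>A. finite A \<Longrightarrow> coef p H A = 0"
  shows "AE \<omega> in M. H \<omega> = 0"
proof -
  have [measurable]: "H \<in> borel_measurable M" using H by simp
  \<comment> \<open>\<open>ennreal\<close> truncates negative reals to 0, so these densities are the
    positive and the negative part.\<close>
  define P where "P = density M (\<lambda>\<omega>. ennreal (H \<omega>))"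
  define Q where "Q = density M (\<lambda>\<omega>. ennreal (- H \<omega>))"
  have fin: "(\<integral>\<^sup>+\<omega>. ennreal (H \<omega>) \<partial>M) < \<infinity>" "(\<integral>\<^sup>+\<omega>. ennreal (- H \<omega>) \<partial>M) < \<infinity>"
    using H by (auto simp: real_integrable_def less_top)
  have "P = Q"
  proof (rule measure_eqI_PiM_infinite)
    show "sets P = sets (PiM UNIV coin)" "sets Q = sets (PiM UNIV coin)"
      by (simp_all add: P_def Q_def rademacher_eq)
    show "finite_measure P"
    proof
      have "emeasure P (space P) = (\<integral>\<^sup>+\<omega>. ennreal (H \<omega>) * indicator (space M) \<omega> \<partial>M)"
        unfolding P_def by (simp add: emeasure_density)
      also have "\<dots> = (\<integral>\<^sup>+\<omega>. ennreal (H \<omega>) \<partial>M)"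
        by (intro nn_integral_cong) auto
      finally show "emeasure P (space P) \<noteq> \<infinity>" using fin by simp
    qed
    fix E J assume J: "finite J" "J \<subseteq> UNIV" and E: "\<And>i. i \<in> J \<Longrightarrow> E i \<in> sets (coin i)"
    define C where "C = prod_emb UNIV coin J (Pi\<^sub>E J E)"
    have C[measurable]: "C \<in> sets M"
      unfolding C_def rademacher_eq using J E by (intro sets_PiM_I) auto
    have "integrable M (\<lambda>\<omega>. H \<omega> * indicator C \<omega>)"
      using integrable_mult_indicator[OF C H] by (simp add: mult.commute)
    then have int: "(\<integral>\<^sup>+\<omega>. ennreal (H \<omega> * indicator C \<omega>) \<partial>M) < \<infinity>"
        "(\<integral>\<^sup>+\<omega>. ennreal (- (H \<omega> * indicator C \<omega>)) \<partial>M) < \<infinity>"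
      by (auto simp: real_integrable_def less_top)
    have "(\<integral>\<omega>. H \<omega> * indicator C \<omega> \<partial>M) = 0"
      unfolding C_def by (rule coef_eq_0_imp_integral_cylinder) (use H coef J E in auto)
    then have "enn2real (\<integral>\<^sup>+\<omega>. ennreal (H \<omega> * indicator C \<omega>) \<partial>M) =
        enn2real (\<integral>\<^sup>+\<omega>. ennreal (- (H \<omega> * indicator C \<omega>)) \<partial>M)"
      by (subst (asm) real_lebesgue_integral_def) (use \<open>integrable M (\<lambda>\<omega>. H \<omega> * indicator C \<omega>)\<close> in auto)
    then have eq: "(\<integral>\<^sup>+\<omega>. ennreal (H \<omega> * indicator C \<omega>) \<partial>M) =
        (\<integral>\<^sup>+\<omega>. ennreal (- (H \<omega> * indicator C \<omega>)) \<partial>M)"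
      using int by (metis ennreal_enn2real infinity_ennreal_def)
    have "emeasure P C = (\<integral>\<^sup>+\<omega>. ennreal (H \<omega> * indicator C \<omega>) \<partial>M)"
      unfolding P_def
      by (subst emeasure_density) (auto intro!: nn_integral_cong split: split_indicator)
    also have "\<dots> = (\<integral>\<^sup>+\<omega>. ennreal (- (H \<omega> * indicator C \<omega>)) \<partial>M)"
      by (rule eq)
    also have "\<dots> = emeasure Q C"
      unfolding Q_def
      by (subst emeasure_density) (auto intro!: nn_integral_cong split: split_indicator)
    finally show "emeasure P (prod_emb UNIV coin J (Pi\<^sub>E J E)) = emeasure Q (prod_emb UNIV coin J (Pi\<^sub>E J E))"
      by (simp add: C_def)
  qed
  then have "AE \<omega> in M. ennreal (H \<omega>) = ennreal (- H \<omega>)"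
    unfolding P_def Q_def by (intro density_unique) auto
  then show ?thesis
  proof eventually_elim
    case (elim \<omega>)
    show "H \<omega> = 0"
    proof (cases "H \<omega> \<ge> 0")
      case True
      then have "ennreal (H \<omega>) = 0" using elim by (simp add: ennreal_neg)
      then show ?thesis using True by simp
    next
      case False
      then have "ennreal (- H \<omega>) = 0" using elim by (simp add: ennreal_neg)
      then show ?thesis using False by simp
    qed
  qed
qed

end

section \<open>Parseval identity\<close>

abbreviation Fin :: "nat set set" where
  "Fin \<equiv> {A. finite A}"

text \<open>Binary codes enumerate the orthonormal system by natural numbers, which opens sums over
  \<open>Fin\<close> to results on sequences and series.\<close>

lemma bij_betw_set_decode: "bij_betw set_decode UNIV Fin"
  by (rule bij_betw_byWitness[where f' = set_encode]) auto

context rademacher_product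
begin

lemma coef_add:
  assumes "F \<in> L2 M" "G \<in> L2 M" "finite A"
  shows "coef p (\<lambda>\<omega>. F \<omega> + G \<omega>) A = coef p F A + coef p G A"
  using integrable_mult_Yprod[OF L2_integrable[OF assms(1)] assms(3)]
    integrable_mult_Yprod[OF L2_integrable[OF assms(2)] assms(3)]
  by (simp add: coef_def distrib_right)

lemma coef_diff:
  assumes "integrable M F" "integrable M G" "finite A"
  shows "coef p (\<lambda>\<omega>. F \<omega> - G \<omega>) A = coef p F A - coef p G A"
  using integrable_mult_Yprod[OF assms(1,3)] integrable_mult_Yprod[OF assms(2,3)]
  by (simp add: coef_def left_diff_distrib)

lemma coef_cmult: "coef p (\<lambda>\<omega>. c * F \<omega>) A = c * coef p F A"
  by (simp add: coef_def mult.assoc)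

lemma coef_sum:
  assumes "\<And>i. i \<in> I \<Longrightarrow> F i \<in> L2 M" "finite A"
  shows "coef p (\<lambda>\<omega>. \<Sum>i\<in>I. F i \<omega>) A = (\<Sum>i\<in>I. coef p (F i) A)"
  using assms unfolding coef_def sum_distrib_right
  by (intro Bochner_Integration.integral_sum integrable_mult_Yprod L2_integrable) auto

lemma Ysum_L2: "T \<subseteq> Fin \<Longrightarrow> (\<lambda>\<omega>. \<Sum>A\<in>T. c A * Yprod p A \<omega>) \<in> L2 M"
  by (intro L2_sum L2_cmult Yprod_L2) auto

lemma coef_Ysum:
  assumes "finite T" "T \<subseteq> Fin" "finite B"
  shows "coef p (\<lambda>\<omega>. \<Sum>A\<in>T. c A * Yprod p A \<omega>) B = (if B \<in> T then c B else 0)"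
proof -
  have "coef p (\<lambda>\<omega>. \<Sum>A\<in>T. c A * Yprod p A \<omega>) B = (\<Sum>A\<in>T. c A * coef p (Yprod p A) B)"
    using assms by (subst coef_sum) (auto simp: coef_cmult intro!: L2_cmult Yprod_L2)
  also have "\<dots> = (\<Sum>A\<in>T. if A = B then c B else 0)"
  proof (intro sum.cong refl)
    fix A assume "A \<in> T"
    then have "finite A" using assms by auto
    then show "c A * coef p (Yprod p A) B = (if A = B then c B else 0)"
      using assms by (simp add: coef_Yprod)
  qed
  finally show ?thesis using assms by simp
qed

lemma integral_mult_Ysum:
  assumes "H \<in> L2 M" "T \<subseteq> Fin"
  shows "(\<integral>\<omega>. H \<omega> * (\<Sum>A\<in>T. c A * Yprod p A \<omega>) \<partial>M) = (\<Sum>A\<in>T. c A * coef p H A)"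
proof -
  have "(\<integral>\<omega>. H \<omega> * (\<Sum>A\<in>T. c A * Yprod p A \<omega>) \<partial>M) =
      (\<integral>\<omega>. (\<Sum>A\<in>T. c A * (H \<omega> * Yprod p A \<omega>)) \<partial>M)"
    by (simp add: sum_distrib_left mult_ac)
  also have "\<dots> = (\<Sum>A\<in>T. \<integral>\<omega>. c A * (H \<omega> * Yprod p A \<omega>) \<partial>M)"
    using assms
    by (intro Bochner_Integration.integral_sum integrable_mult_right integrable_mult_Yprod L2_integrable) auto
  finally show ?thesis by (simp add: coef_def)
qed

lemma Ysum_norm:
  assumes "finite T" "T \<subseteq> Fin"
  shows "(\<integral>\<omega>. (\<Sum>A\<in>T. c A * Yprod p A \<omega>)\<^sup>2 \<partial>M) = (\<Sum>A\<in>T. (c A)\<^sup>2)"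
proof -
  have "(\<integral>\<omega>. (\<Sum>A\<in>T. c A * Yprod p A \<omega>)\<^sup>2 \<partial>M)
      = (\<Sum>A\<in>T. c A * coef p (\<lambda>\<omega>. \<Sum>A\<in>T. c A * Yprod p A \<omega>) A)"
    unfolding power2_eq_square using assms by (intro integral_mult_Ysum Ysum_L2)
  also have "\<dots> = (\<Sum>A\<in>T. (c A)\<^sup>2)"
  proof (intro sum.cong refl)
    fix B assume "B \<in> T"
    moreover from this have "finite B" using assms by auto
    ultimately show "c B * coef p (\<lambda>\<omega>. \<Sum>A\<in>T. c A * Yprod p A \<omega>) B = (c B)\<^sup>2"
      using assms by (simp add: coef_Ysum power2_eq_square)
  qed
  finally show ?thesis .
qed

lemma Bessel:
  assumes H: "H \<in> L2 M" and T: "finite T" "T \<subseteq> Fin"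
  shows "(\<Sum>A\<in>T. (coef p H A)\<^sup>2) \<le> (\<integral>\<omega>. (H \<omega>)\<^sup>2 \<partial>M)"
proof -
  define S where "S \<omega> = (\<Sum>A\<in>T. coef p H A * Yprod p A \<omega>)" for \<omega>
  have S: "S \<in> L2 M" unfolding S_def using T by (intro Ysum_L2)
  have HS: "(\<integral>\<omega>. H \<omega> * S \<omega> \<partial>M) = (\<Sum>A\<in>T. (coef p H A)\<^sup>2)"
    unfolding S_def using integral_mult_Ysum[OF H T(2)] by (simp add: power2_eq_square)
  have SS: "(\<integral>\<omega>. (S \<omega>)\<^sup>2 \<partial>M) = (\<Sum>A\<in>T. (coef p H A)\<^sup>2)"
    unfolding S_def by (rule Ysum_norm[OF T])
  have "0 \<le> (\<integral>\<omega>. (H \<omega> - S \<omega>)\<^sup>2 \<partial>M)" by simp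
  also have "(\<lambda>\<omega>. (H \<omega> - S \<omega>)\<^sup>2) = (\<lambda>\<omega>. (H \<omega>)\<^sup>2 - 2 * (H \<omega> * S \<omega>) + (S \<omega>)\<^sup>2)"
    by (auto simp: power2_eq_square algebra_simps)
  also have "(\<integral>\<omega>. (H \<omega>)\<^sup>2 - 2 * (H \<omega> * S \<omega>) + (S \<omega>)\<^sup>2 \<partial>M) =
      (\<integral>\<omega>. (H \<omega>)\<^sup>2 \<partial>M) - 2 * (\<integral>\<omega>. H \<omega> * S \<omega> \<partial>M) + (\<integral>\<omega>. (S \<omega>)\<^sup>2 \<partial>M)"
    using L2_integrable_square[OF H] L2_integrable_square[OF S] L2_integrable_mult[OF H S] by simp
  finally show ?thesis by (simp add: HS SS)
qed

text \<open>Along the binary enumeration, the squared norm of a difference of partial sums is a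
  block of the given series, so they are Cauchy. Continuity of inner product and norm identifies the
  coefficients and the norm of the limit.\<close>

lemma Riesz_Fischer:
  assumes c: "(\<lambda>A. (c A)\<^sup>2) summable_on Fin"
  obtains H where "H \<in> L2 M" "\<And>A. finite A \<Longrightarrow> coef p H A = c A"
    "((\<lambda>A. (c A)\<^sup>2) has_sum (\<integral>\<omega>. (H \<omega>)\<^sup>2 \<partial>M)) Fin"
proof -
  define g where "g m = (c (set_decode m))\<^sup>2" for m
  have inj: "inj_on set_decode B" for B
    by (metis inj_on_inverseI set_decode_inverse)
  have "g summable_on UNIV"
    using c summable_on_reindex_bij_betw[OF bij_betw_set_decode, of "\<lambda>A. (c A)\<^sup>2"]
    by (simp add: g_def[abs_def])
  then have g: "summable g"
    by (rule summable_on_imp_summable)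
  define S where "S n \<omega> = (\<Sum>A\<in>set_decode ` {..<n}. c A * Yprod p A \<omega>)" for n \<omega>
  have S: "S n \<in> L2 M" for n
    unfolding S_def by (intro Ysum_L2) auto
  have diff: "(\<integral>\<omega>. (S n \<omega> - S m \<omega>)\<^sup>2 \<partial>M) = (\<Sum>i=m..<n. g i)" if "m \<le> n" for m n
  proof -
    have "S n \<omega> - S m \<omega> = (\<Sum>A\<in>set_decode ` {m..<n}. c A * Yprod p A \<omega>)" for \<omega>
    proof -
      have "{..<n} = {..<m} \<union> {m..<n}" "{..<m} \<inter> {m..<n} = {}"
        using that by auto
      then show ?thesis
        by (simp add: S_def sum.reindex[OF inj] sum.union_disjoint)
    qed
    then have "(\<integral>\<omega>. (S n \<omega> - S m \<omega>)\<^sup>2 \<partial>M) = (\<Sum>A\<in>set_decode ` {m..<n}. (c A)\<^sup>2)"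
      by (simp add: Ysum_norm image_subset_iff)
    then show ?thesis by (simp add: sum.reindex[OF inj] g_def)
  qed
  have "\<exists>H. L2_tendsto M S H sequentially"
  proof (rule L2_complete[of S])
    show "\<exists>N. \<forall>m\<ge>N. \<forall>n\<ge>N. (\<integral>\<omega>. (S m \<omega> - S n \<omega>)\<^sup>2 \<partial>M) < e" if "e > 0" for e
    proof -
      obtain N where N: "\<And>m n. m \<ge> N \<Longrightarrow> norm (sum g {m..<n}) < e"
        using g \<open>e > 0\<close> unfolding summable_Cauchy by blast
      have "(\<integral>\<omega>. (S m \<omega> - S n \<omega>)\<^sup>2 \<partial>M) < e" if "m \<ge> N" "n \<ge> N" for m n
      proof (cases "m \<le> n")
        case True
        then show ?thesis
          using diff[OF True] N[OF that(1), of n] by (simp add: power2_commute)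
      next
        case False
        then show ?thesis
          using diff[of n m] N[OF that(2), of m] by simp
      qed
      then show ?thesis by blast
    qed
  qed (use S in auto)
  then obtain H where lim: "L2_tendsto M S H sequentially" by blast
  have H: "H \<in> L2 M" using lim by (simp add: L2_tendsto_def)
  have "coef p H A = c A" if A: "finite A" for A
  proof -
    have "(\<lambda>n. coef p (S n) A) \<longlonglongrightarrow> coef p H A"
      unfolding coef_def by (rule L2_tendsto_inner[OF lim Yprod_L2[OF A]])
    moreover have "\<forall>\<^sub>F n in sequentially. coef p (S n) A = c A"
      using eventually_gt_at_top[of "set_encode A"]
    proof eventually_elim
      case (elim n)
      then have "A \<in> set_decode ` {..<n}"
        using A by (intro image_eqI[of _ _ "set_encode A"]) auto
      then show ?case
        unfolding S_def using A by (subst coef_Ysum) auto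
    qed
    ultimately show ?thesis
        by (rule LIMSEQ_unique[OF _ tendsto_eventually])
  qed
  moreover have "((\<lambda>A. (c A)\<^sup>2) has_sum (\<integral>\<omega>. (H \<omega>)\<^sup>2 \<partial>M)) Fin"
  proof -
    have "(\<lambda>n. \<integral>\<omega>. (S n \<omega>)\<^sup>2 \<partial>M) \<longlonglongrightarrow> (\<integral>\<omega>. (H \<omega>)\<^sup>2 \<partial>M)"
      by (rule L2_tendsto_norm[OF lim])
    moreover have "(\<integral>\<omega>. (S n \<omega>)\<^sup>2 \<partial>M) = sum g {..<n}" for n
      unfolding S_def by (subst Ysum_norm) (auto simp: sum.reindex[OF inj] g_def)
    ultimately have "g sums (\<integral>\<omega>. (H \<omega>)\<^sup>2 \<partial>M)"
      by (simp add: sums_def)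
    then have "(g has_sum (\<integral>\<omega>. (H \<omega>)\<^sup>2 \<partial>M)) UNIV"
      by (rule sums_nonneg_imp_has_sum) (simp add: g_def)
    then show ?thesis
      unfolding g_def
      using has_sum_reindex_bij_betw[OF bij_betw_set_decode, of "\<lambda>A. (c A)\<^sup>2"] by simp
  qed
  ultimately show thesis using H that by blast
qed

lemma coef_eq_imp_AE_eq:
  assumes "integrable M F" "integrable M G" "\<And>A. finite A \<Longrightarrow> coef p F A = coef p G A"
  shows "AE \<omega> in M. F \<omega> = G \<omega>"
proof -
  have "AE \<omega> in M. F \<omega> - G \<omega> = 0"
    by (rule coef_eq_0_imp_AE_0) (use assms in \<open>auto simp: coef_diff\<close>)
  then show ?thesis by simp
qed

lemma coef_square_summable:
  assumes "H \<in> L2 M"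
  shows "(\<lambda>A. (coef p H A)\<^sup>2) summable_on Fin"
  by (rule nonneg_bdd_above_summable_on) (use Bessel[OF assms] in \<open>auto intro!: bdd_aboveI2\<close>)

text \<open>Riesz-Fischer rebuilds a function with the coefficients of H and the right norm; by
  uniqueness of coefficients it equals H almost surely.\<close>

theorem Parseval:
  assumes H: "H \<in> L2 M"
  shows "((\<lambda>A. (coef p H A)\<^sup>2) has_sum (\<integral>\<omega>. (H \<omega>)\<^sup>2 \<partial>M)) Fin"
proof -
  obtain H' where H': "H' \<in> L2 M" "\<And>A. finite A \<Longrightarrow> coef p H' A = coef p H A"
    and sum: "((\<lambda>A. (coef p H A)\<^sup>2) has_sum (\<integral>\<omega>. (H' \<omega>)\<^sup>2 \<partial>M)) Fin"
    using Riesz_Fischer[OF coef_square_summable[OF H]] by blast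
  have [measurable]: "H \<in> borel_measurable M" "H' \<in> borel_measurable M"
    using H H'(1) by (auto intro: L2_measurable)
  have "AE \<omega> in M. H' \<omega> = H \<omega>"
    using H H' by (intro coef_eq_imp_AE_eq L2_integrable)
  then have "(\<integral>\<omega>. (H' \<omega>)\<^sup>2 \<partial>M) = (\<integral>\<omega>. (H \<omega>)\<^sup>2 \<partial>M)"
    by (intro integral_cong_AE) auto
  then show ?thesis using sum by simp
qed

lemma Parseval_inner:
  assumes F: "F \<in> L2 M" and G: "G \<in> L2 M"
  shows "((\<lambda>A. coef p F A * coef p G A) has_sum (\<integral>\<omega>. F \<omega> * G \<omega> \<partial>M)) Fin"
proof -
  have "((\<lambda>A. (1/2) * ((coef p (\<lambda>\<omega>. F \<omega> + G \<omega>) A)\<^sup>2 + (-1) * ((coef p F A)\<^sup>2 + (coef p G A)\<^sup>2))) has_sum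
      (1/2) * ((\<integral>\<omega>. (F \<omega> + G \<omega>)\<^sup>2 \<partial>M) + (-1) * ((\<integral>\<omega>. (F \<omega>)\<^sup>2 \<partial>M) + (\<integral>\<omega>. (G \<omega>)\<^sup>2 \<partial>M)))) Fin"
    by (intro has_sum_cmult_right has_sum_add Parseval L2_add F G)
  moreover have "(\<integral>\<omega>. (F \<omega> + G \<omega>)\<^sup>2 \<partial>M) =
      (\<integral>\<omega>. (F \<omega>)\<^sup>2 \<partial>M) + (\<integral>\<omega>. (G \<omega>)\<^sup>2 \<partial>M) + 2 * (\<integral>\<omega>. F \<omega> * G \<omega> \<partial>M)"
  proof -
    have "(\<lambda>\<omega>. (F \<omega> + G \<omega>)\<^sup>2) = (\<lambda>\<omega>. (F \<omega>)\<^sup>2 + (G \<omega>)\<^sup>2 + 2 * (F \<omega> * G \<omega>))"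
      by (auto simp: power2_eq_square algebra_simps)
    then show ?thesis
      using L2_integrable_square[OF F] L2_integrable_square[OF G] L2_integrable_mult[OF F G] by simp
  qed
  moreover have "(1/2) * ((coef p (\<lambda>\<omega>. F \<omega> + G \<omega>) A)\<^sup>2 + (-1) * ((coef p F A)\<^sup>2 + (coef p G A)\<^sup>2))
      = coef p F A * coef p G A" if "A \<in> Fin" for A
    using that by (simp add: coef_add[OF F G] power2_sum)
  ultimately show ?thesis
    using has_sum_cong[of Fin "\<lambda>A. (1/2) * ((coef p (\<lambda>\<omega>. F \<omega> + G \<omega>) A)\<^sup>2 + (-1) * ((coef p F A)\<^sup>2 + (coef p G A)\<^sup>2))"
      "\<lambda>A. coef p F A * coef p G A"] by simp
qed

text \<open>Dominated convergence for coefficients. Each single coefficient is eventually exact, so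
  any finite set of them contributes nothing in the end, while the tail of b controls the
  rest.\<close>

lemma L2_tendstoI_coef:
  assumes H: "H \<in> L2 M" and b: "b summable_on Fin"
    and S: "\<forall>\<^sub>F i in \<F>. S i \<in> L2 M \<and> (\<forall>A. finite A \<longrightarrow> (coef p (S i) A - coef p H A)\<^sup>2 \<le> b A)"
    and eq: "\<And>A. finite A \<Longrightarrow> \<forall>\<^sub>F i in \<F>. coef p (S i) A = coef p H A"
  shows "L2_tendsto M S H \<F>"
proof -
  have "((\<lambda>i. \<integral>\<omega>. (S i \<omega> - H \<omega>)\<^sup>2 \<partial>M) \<longlongrightarrow> 0) \<F>"
  proof (rule tendstoI)
    fix e :: real assume "e > 0"
    then obtain U where U: "finite U" "U \<subseteq> Fin" "dist (sum b U) (infsum b Fin) \<le> e / 2"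
      using infsum_finite_approximation[OF b, of "e / 2"] by auto
    have tail: "(b has_sum (infsum b Fin - sum b U)) (Fin - U)"
      using b U by (intro has_sum_Diff) auto
    have "\<forall>\<^sub>F i in \<F>. \<forall>A\<in>U. coef p (S i) A = coef p H A"
      using U eq by (intro eventually_ball_finite) auto
    with S show "\<forall>\<^sub>F i in \<F>. dist (\<integral>\<omega>. (S i \<omega> - H \<omega>)\<^sup>2 \<partial>M) 0 < e"
    proof eventually_elim
      case (elim i)
      then have Si: "S i \<in> L2 M" by simp
      have "((\<lambda>A. (coef p (\<lambda>\<omega>. S i \<omega> - H \<omega>) A)\<^sup>2) has_sum (\<integral>\<omega>. (S i \<omega> - H \<omega>)\<^sup>2 \<partial>M)) Fin"
        by (intro Parseval L2_diff Si H)
      then have "(\<integral>\<omega>. (S i \<omega> - H \<omega>)\<^sup>2 \<partial>M) \<le> infsum b Fin - sum b U"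
        by (rule has_sum_mono_neutral[OF _ tail])
          (use elim Si H in \<open>auto simp: coef_diff L2_integrable\<close>)
      also have "\<dots> \<le> e / 2"
        using U(3) unfolding dist_real_def by linarith
      finally show ?case
        using \<open>e > 0\<close> by simp
    qed
  qed
  moreover have "\<forall>\<^sub>F i in \<F>. S i \<in> L2 M"
    using S by eventually_elim simp
  ultimately show ?thesis using H by (simp add: L2_tendsto_def)
qed

end

section \<open>Chaos expansion and the Ornstein--Uhlenbeck semigroup\<close>

text \<open>A set of size n is listed by n! multi-indices with distinct entries. A finite T catches
  a fraction of these; that fraction is the share of the coefficient of A collected by the partial
  sum over T.\<close>

lemma sum_indicator_permutations:
  fixes c :: real
  assumes "finite T" "T \<subseteq> \<Delta> n" "finite A" "card A = n"
  shows "(\<Sum>is\<in>T. if set is = A then c / fact n else 0) = card (T \<inter> permutations_of_set A) / fact n * c"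
    and "card (T \<inter> permutations_of_set A) \<le> (fact n :: real)"
    and "permutations_of_set A \<subseteq> T \<Longrightarrow> card (T \<inter> permutations_of_set A) = (fact n :: real)"
proof -
  have "T \<inter> permutations_of_set A = {is \<in> T. set is = A}"
    using assms by (auto simp: permutations_of_set_def \<Delta>_def)
  then show "(\<Sum>is\<in>T. if set is = A then c / fact n else 0) = card (T \<inter> permutations_of_set A) / fact n * c"
    using assms by (simp add: sum.If_cases Int_def)
  have "card (T \<inter> permutations_of_set A) \<le> card (permutations_of_set A)"
    by (intro card_mono) auto
  then show "card (T \<inter> permutations_of_set A) \<le> (fact n :: real)"
    using assms by (metis card_permutations_of_set of_nat_fact of_nat_le_iff)
  show "card (T \<inter> permutations_of_set A) = (fact n :: real)" if "permutations_of_set A \<subseteq> T"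
    using that assms by (simp add: Int_absorb1)
qed

context rademacher_product
begin

section \<open>Coefficients of multiple integrals and of the semigroup\<close>

lemma L2_norm_mono_coef:
  assumes "F \<in> L2 M" "H \<in> L2 M" "\<And>A. finite A \<Longrightarrow> (coef p H A)\<^sup>2 \<le> (coef p F A)\<^sup>2"
  shows "(\<integral>\<omega>. (H \<omega>)\<^sup>2 \<partial>M) \<le> (\<integral>\<omega>. (F \<omega>)\<^sup>2 \<partial>M)"
  using Parseval[OF assms(2)] Parseval[OF assms(1)] by (rule has_sum_mono) (use assms(3) in auto)

text \<open>Distinct entries turn the product over a multi-index into \<open>Yprod\<close> of its
  set, after which orthonormality reads off the coefficients.\<close>

lemma
  assumes T: "finite T" "T \<subseteq> \<Delta> n"
  shows list_sum_L2: "(\<lambda>\<omega>. \<Sum>is\<in>T. f is * (\<Prod>i\<leftarrow>is. Y p i \<omega>)) \<in> L2 M"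
    and coef_list_sum: "finite A \<Longrightarrow> coef p (\<lambda>\<omega>. \<Sum>is\<in>T. f is * (\<Prod>i\<leftarrow>is. Y p i \<omega>)) A =
      (\<Sum>is\<in>T. if set is = A then f is else 0)"
proof -
  have eq: "(\<lambda>\<omega>. \<Sum>is\<in>T. f is * (\<Prod>i\<leftarrow>is. Y p i \<omega>)) = (\<lambda>\<omega>. \<Sum>is\<in>T. f is * Yprod p (set is) \<omega>)"
  proof (intro ext sum.cong refl)
    fix \<omega> "is" assume "is \<in> T"
    then have "distinct is" using T by (auto simp: \<Delta>_def)
    then show "f is * (\<Prod>i\<leftarrow>is. Y p i \<omega>) = f is * Yprod p (set is) \<omega>"
      by (simp add: Yprod_def prod.distinct_set_conv_list)
  qed
  show "(\<lambda>\<omega>. \<Sum>is\<in>T. f is * (\<Prod>i\<leftarrow>is. Y p i \<omega>)) \<in> L2 M"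
    unfolding eq by (intro L2_sum L2_cmult Yprod_L2) auto
  show "coef p (\<lambda>\<omega>. \<Sum>is\<in>T. f is * (\<Prod>i\<leftarrow>is. Y p i \<omega>)) A = (\<Sum>is\<in>T. if set is = A then f is else 0)"
    if A: "finite A"
  proof -
    have "coef p (\<lambda>\<omega>. \<Sum>is\<in>T. f is * Yprod p (set is) \<omega>) A = (\<Sum>is\<in>T. f is * coef p (Yprod p (set is)) A)"
      using A by (subst coef_sum) (auto simp: coef_cmult intro!: L2_cmult Yprod_L2)
    also have "\<dots> = (\<Sum>is\<in>T. if set is = A then f is else 0)"
      using A by (intro sum.cong refl) (simp add: coef_Yprod)
    finally show ?thesis unfolding eq .
  qed
qed

lemma eventually_finite_subset:
  "\<forall>\<^sub>F T in finite_subsets_at_top S. finite T \<and> T \<subseteq> S"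
  by (rule eventually_finite_subsets_at_top_weakI) simp

text \<open>The finite sums defining the multiple integral involve only sets of size n, and
  coefficients pass to the limit. This is the orthogonality of the chaoses.\<close>

lemma coef_multiple_integral:
  assumes J: "is_multiple_integral p n f H" and A: "finite A" "card A \<noteq> n"
  shows "coef p H A = 0"
proof -
  have lim: "L2_tendsto M (\<lambda>T \<omega>. \<Sum>is\<in>T. f is * (\<Prod>i\<leftarrow>is. Y p i \<omega>)) H (finite_subsets_at_top (\<Delta> n))"
    using J by (simp add: is_multiple_integral_def)
  have "\<forall>\<^sub>F T in finite_subsets_at_top (\<Delta> n). coef p (\<lambda>\<omega>. \<Sum>is\<in>T. f is * (\<Prod>i\<leftarrow>is. Y p i \<omega>)) A = 0"
    using eventually_finite_subset
  proof eventually_elim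
    case (elim T)
    then have "set is \<noteq> A" if "is \<in> T" for "is"
      using that A by (auto simp: \<Delta>_def distinct_card)
    then show ?case
      using elim A by (auto simp: coef_list_sum intro!: sum.neutral)
  qed
  then have "((\<lambda>T. coef p (\<lambda>\<omega>. \<Sum>is\<in>T. f is * (\<Prod>i\<leftarrow>is. Y p i \<omega>)) A) \<longlongrightarrow> 0) (finite_subsets_at_top (\<Delta> n))"
    by (rule tendsto_eventually)
  moreover have "((\<lambda>T. coef p (\<lambda>\<omega>. \<Sum>is\<in>T. f is * (\<Prod>i\<leftarrow>is. Y p i \<omega>)) A) \<longlongrightarrow> coef p H A) (finite_subsets_at_top (\<Delta> n))"
    unfolding coef_def by (rule L2_tendsto_inner[OF lim Yprod_L2[OF A(1)]])
  ultimately show ?thesis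
    by (intro tendsto_unique[OF finite_subsets_at_top_neq_bot])
qed

lemma coef_weighted_chaos_sum:
  assumes J: "\<And>n. J n \<in> L2 M" "\<And>n. card A \<noteq> n \<Longrightarrow> coef p (J n) A = 0" and A: "finite A"
  shows "coef p (\<lambda>\<omega>. \<Sum>n<N. w n * J n \<omega>) A = (if card A < N then w (card A) * coef p (J (card A)) A else 0)"
proof -
  have "coef p (\<lambda>\<omega>. \<Sum>n<N. w n * J n \<omega>) A = (\<Sum>n<N. w n * coef p (J n) A)"
    using J A by (subst coef_sum) (auto simp: coef_cmult intro: L2_cmult)
  also have "\<dots> = (\<Sum>n<N. if n = card A then w (card A) * coef p (J (card A)) A else 0)"
    using J by (intro sum.cong refl) auto
  finally show ?thesis by simp
qed

text \<open>No two chaos components share a coefficient, so A sees only the one of order |A|. The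
  weights 1 and exp (- n t) treat a function and its image under the semigroup alike.\<close>

lemma coef_weighted_chaos_limit:
  assumes J: "\<And>n. is_multiple_integral p n (f n) (J n)" and A: "finite A"
    and lim: "L2_tendsto M (\<lambda>N \<omega>. \<Sum>n<N. w n * J n \<omega>) H sequentially"
  shows "coef p H A = w (card A) * coef p (J (card A)) A"
proof -
  have L2: "J n \<in> L2 M" for n
    using J by (simp add: is_multiple_integral_def L2_tendsto_def)
  have "\<forall>\<^sub>F N in sequentially. coef p (\<lambda>\<omega>. \<Sum>n<N. w n * J n \<omega>) A = w (card A) * coef p (J (card A)) A"
    using eventually_gt_at_top[of "card A"]
    by eventually_elim (use coef_weighted_chaos_sum[OF L2 coef_multiple_integral[OF J] A] A in simp)
  then have "(\<lambda>N. coef p (\<lambda>\<omega>. \<Sum>n<N. w n * J n \<omega>) A) \<longlonglongrightarrow> w (card A) * coef p (J (card A)) A"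
    by (rule tendsto_eventually)
  moreover have "(\<lambda>N. coef p (\<lambda>\<omega>. \<Sum>n<N. w n * J n \<omega>) A) \<longlonglongrightarrow> coef p H A"
    unfolding coef_def by (rule L2_tendsto_inner[OF lim Yprod_L2[OF A]])
  ultimately show ?thesis
    by (rule LIMSEQ_unique[symmetric])
qed

text \<open>Comparing the weights 1 and exp (- n t) eliminates the components J, so the result does
  not depend on the expansion chosen in the definition.\<close>

theorem is_OU_imp_coef:
  assumes "is_OU p t K H"
  shows "H \<in> L2 M" and "finite A \<Longrightarrow> coef p H A = exp (- real (card A) * t) * coef p K A"
proof -
  obtain f J where J: "\<And>n. is_multiple_integral p n (f n) (J n)"
    and K: "L2_tendsto M (\<lambda>N \<omega>. \<Sum>n<N. J n \<omega>) K sequentially"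
    and H: "L2_tendsto M (\<lambda>N \<omega>. \<Sum>n<N. exp (- real n * t) * J n \<omega>) H sequentially"
    using assms by (auto simp: is_OU_def chaos_expansion_def)
  show "H \<in> L2 M" using H by (simp add: L2_tendsto_def)
  show "coef p H A = exp (- real (card A) * t) * coef p K A" if A: "finite A"
    using coef_weighted_chaos_limit[OF J A H] coef_weighted_chaos_limit[OF J A, of "\<lambda>_. 1" K] K by simp
qed

text \<open>The symmetric kernel of the n-th chaos component; 1 / n! compensates for the n!
  orderings of one set in the sum over \<open>\<Delta> n\<close>.\<close>

definition chaos_kernel :: "((nat \<Rightarrow> real) \<Rightarrow> real) \<Rightarrow> nat \<Rightarrow> nat list \<Rightarrow> real" where
  "chaos_kernel K n is = (if is \<in> \<Delta> n then coef p K (set is) / fact n else 0)"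

lemma chaos_kernel_sym_l2:
  assumes K: "K \<in> L2 M"
  shows "chaos_kernel K n \<in> sym_l2 n"
proof -
  let ?k = "chaos_kernel K n"
  have "(\<lambda>is. (?k is)\<^sup>2) summable_on {is. length is = n}"
  proof (rule nonneg_bdd_above_summable_on)
    have "sum (\<lambda>is. (?k is)\<^sup>2) T \<le> (\<integral>\<omega>. (K \<omega>)\<^sup>2 \<partial>M)" if T: "finite T" for T
    proof -
      define T' where "T' = T \<inter> \<Delta> n"
      have T': "finite T'" "T' \<subseteq> \<Delta> n" using T by (auto simp: T'_def)
      have "sum (\<lambda>is. (?k is)\<^sup>2) T = (\<Sum>is\<in>T'. (coef p K (set is))\<^sup>2 / fact n / fact n)"
        unfolding T'_def using T
        by (intro sum.mono_neutral_cong_right) (auto simp: chaos_kernel_def power2_eq_square)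
      \<comment> \<open>One of the two factors 1 / n! is bounded by 1; the other pays for the at
        most n! multi-indices that share a set.\<close>
      also have "\<dots> \<le> (\<Sum>is\<in>T'. (coef p K (set is))\<^sup>2 / fact n)"
        using divide_left_mono[of 1 "fact n :: real" "_ / fact n"] by (intro sum_mono) (simp add: fact_ge_1)
      also have "\<dots> = (\<Sum>A\<in>set ` T'. \<Sum>is\<in>{is\<in>T'. set is = A}. (coef p K (set is))\<^sup>2 / fact n)"
        by (rule sum.image_gen[OF T'(1)])
      also have "\<dots> \<le> (\<Sum>A\<in>set ` T'. (coef p K A)\<^sup>2)"
      proof (rule sum_mono)
        fix A assume "A \<in> set ` T'"
        then have A: "finite A" "card A = n" using T' by (auto simp: \<Delta>_def distinct_card)
        have "(\<Sum>is\<in>{is\<in>T'. set is = A}. (coef p K (set is))\<^sup>2 / fact n)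
            = (\<Sum>is\<in>T'. if set is = A then (coef p K A)\<^sup>2 / fact n else 0)"
          using T' by (intro sum.mono_neutral_cong_left) auto
        also have "\<dots> = card (T' \<inter> permutations_of_set A) / fact n * (coef p K A)\<^sup>2"
          by (rule sum_indicator_permutations[OF T' A])
        also have "\<dots> \<le> 1 * (coef p K A)\<^sup>2"
          using sum_indicator_permutations(2)[OF T' A]
          by (intro mult_right_mono) (auto simp: divide_le_eq)
        finally show "(\<Sum>is\<in>{is\<in>T'. set is = A}. (coef p K (set is))\<^sup>2 / fact n) \<le> (coef p K A)\<^sup>2"
          by simp
      qed
      also have "\<dots> \<le> (\<integral>\<omega>. (K \<omega>)\<^sup>2 \<partial>M)"
        using T' by (intro Bessel K) auto
      finally show ?thesis .
    qed
    then show "bdd_above (sum (\<lambda>is. (?k is)\<^sup>2) ` {F. F \<subseteq> {is. length is = n} \<and> finite F})"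
      by (auto intro!: bdd_aboveI2)
  qed simp
  moreover have "?k js = ?k is" if "mset js = mset is" for "is" js
    using that mset_eq_setD[OF that] mset_eq_imp_distinct_iff[OF that] mset_eq_length[OF that]
    by (simp add: chaos_kernel_def \<Delta>_def)
  ultimately show ?thesis unfolding sym_l2_def by blast
qed

text \<open>If T catches the fraction r of the orderings of A, the partial sum carries r times the
  coefficient c. The error (1 - r)^2 c^2 is dominated by c^2 and vanishes once T contains all
  orderings.\<close>

lemma is_multiple_integral_chaos_kernel:
  assumes K: "K \<in> L2 M" and H: "H \<in> L2 M"
    and coef: "\<And>A. finite A \<Longrightarrow> coef p H A = (if card A = n then coef p K A else 0)"
  shows "is_multiple_integral p n (chaos_kernel K n) H"
proof -
  let ?k = "chaos_kernel K n"
  have coef_T: "coef p (\<lambda>\<omega>. \<Sum>is\<in>T. ?k is * (\<Prod>i\<leftarrow>is. Y p i \<omega>)) A =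
      (if card A = n then card (T \<inter> permutations_of_set A) / fact n * coef p K A else 0)"
    if T: "finite T" "T \<subseteq> \<Delta> n" and A: "finite A" for T A
  proof -
    have "coef p (\<lambda>\<omega>. \<Sum>is\<in>T. ?k is * (\<Prod>i\<leftarrow>is. Y p i \<omega>)) A = (\<Sum>is\<in>T. if set is = A then ?k is else 0)"
      by (rule coef_list_sum[OF T A])
    also have "\<dots> = (\<Sum>is\<in>T. if set is = A then coef p K A / fact n else 0)"
      using T by (intro sum.cong refl) (auto simp: chaos_kernel_def)
    finally have eq: "coef p (\<lambda>\<omega>. \<Sum>is\<in>T. ?k is * (\<Prod>i\<leftarrow>is. Y p i \<omega>)) A = \<dots>" .
    show ?thesis
    proof (cases "card A = n")
      case True
      then show ?thesis using eq sum_indicator_permutations(1)[OF T A True] by simp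
    next
      case False
      then have "set is \<noteq> A" if "is \<in> T" for "is"
        using that T by (auto simp: \<Delta>_def distinct_card)
      then show ?thesis using eq False by (auto intro!: sum.neutral)
    qed
  qed
  have "L2_tendsto M (\<lambda>T \<omega>. \<Sum>is\<in>T. ?k is * (\<Prod>i\<leftarrow>is. Y p i \<omega>)) H (finite_subsets_at_top (\<Delta> n))"
  proof (rule L2_tendstoI_coef[OF H coef_square_summable[OF K]])
    show "\<forall>\<^sub>F T in finite_subsets_at_top (\<Delta> n). (\<lambda>\<omega>. \<Sum>is\<in>T. ?k is * (\<Prod>i\<leftarrow>is. Y p i \<omega>)) \<in> L2 M \<and>
        (\<forall>A. finite A \<longrightarrow> (coef p (\<lambda>\<omega>. \<Sum>is\<in>T. ?k is * (\<Prod>i\<leftarrow>is. Y p i \<omega>)) A - coef p H A)\<^sup>2 \<le> (coef p K A)\<^sup>2)"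
      using eventually_finite_subset
    proof eventually_elim
      case (elim T)
      then have T: "finite T" "T \<subseteq> \<Delta> n" by auto
      have "(coef p (\<lambda>\<omega>. \<Sum>is\<in>T. ?k is * (\<Prod>i\<leftarrow>is. Y p i \<omega>)) A - coef p H A)\<^sup>2 \<le> (coef p K A)\<^sup>2"
        if A: "finite A" for A
      proof (cases "card A = n")
        case True
        define r where "r = card (T \<inter> permutations_of_set A) / (fact n :: real)"
        have "0 \<le> r" "r \<le> 1"
          using sum_indicator_permutations(2)[OF T A True] by (auto simp: r_def)
        then have "(1 - r)\<^sup>2 \<le> 1"
          by (simp add: power_le_one)
        have "(coef p (\<lambda>\<omega>. \<Sum>is\<in>T. ?k is * (\<Prod>i\<leftarrow>is. Y p i \<omega>)) A - coef p H A)\<^sup>2 = (1 - r)\<^sup>2 * (coef p K A)\<^sup>2"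
          using True by (simp add: coef_T[OF T A] coef[OF A] r_def[symmetric] power2_eq_square algebra_simps)
        also have "\<dots> \<le> 1 * (coef p K A)\<^sup>2"
          using \<open>(1 - r)\<^sup>2 \<le> 1\<close> by (rule mult_right_mono) simp
        finally show ?thesis by simp
      next
        case False
        then show ?thesis by (simp add: coef_T[OF T A] coef[OF A])
      qed
      then show ?case using list_sum_L2[OF T] by blast
    qed
    show "\<forall>\<^sub>F T in finite_subsets_at_top (\<Delta> n).
        coef p (\<lambda>\<omega>. \<Sum>is\<in>T. ?k is * (\<Prod>i\<leftarrow>is. Y p i \<omega>)) A = coef p H A" if A: "finite A" for A
    proof (cases "card A = n")
      case True
      have "\<forall>\<^sub>F T in finite_subsets_at_top (\<Delta> n). finite T \<and> permutations_of_set A \<subseteq> T \<and> T \<subseteq> \<Delta> n"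
        unfolding eventually_finite_subsets_at_top
        by (rule exI[of _ "permutations_of_set A"])
          (use True finite_permutations_of_set[of A]
            in \<open>auto simp: permutations_of_set_def \<Delta>_def distinct_card\<close>)
      then show ?thesis
      proof eventually_elim
        case (elim T)
        then show ?case
          using coef_T[of T A] A sum_indicator_permutations(3)[of T n A] True by (simp add: coef)
      qed
    next
      case False
      show ?thesis
        using eventually_finite_subset
        by eventually_elim (use False A in \<open>auto simp: coef_T coef\<close>)
    qed
  qed
  then show ?thesis
    using chaos_kernel_sym_l2[OF K] by (simp add: is_multiple_integral_def)
qed

lemma weighted_chaos_tendsto:
  assumes K: "K \<in> L2 M" and J: "\<And>n. J n \<in> L2 M"
    and coef_J: "\<And>n A. finite A \<Longrightarrow> coef p (J n) A = (if card A = n then coef p K A else 0)"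
    and H: "H \<in> L2 M" "\<And>A. finite A \<Longrightarrow> coef p H A = w (card A) * coef p K A"
    and w: "\<And>n. \<bar>w n\<bar> \<le> 1"
  shows "L2_tendsto M (\<lambda>N \<omega>. \<Sum>n<N. w n * J n \<omega>) H sequentially"
proof (rule L2_tendstoI_coef[OF H(1) coef_square_summable[OF K]])
  have coef_N: "coef p (\<lambda>\<omega>. \<Sum>n<N. w n * J n \<omega>) A = (if card A < N then coef p H A else 0)"
    if A: "finite A" for N A
    using coef_weighted_chaos_sum[of J A w N] J A by (simp add: coef_J H)
  have "(coef p (\<lambda>\<omega>. \<Sum>n<N. w n * J n \<omega>) A - coef p H A)\<^sup>2 \<le> (coef p K A)\<^sup>2" if A: "finite A" for N A
  proof -
    have "\<bar>coef p (\<lambda>\<omega>. \<Sum>n<N. w n * J n \<omega>) A - coef p H A\<bar> \<le> \<bar>w (card A)\<bar> * \<bar>coef p K A\<bar>"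
      using A by (simp add: coef_N H abs_mult)
    also have "\<dots> \<le> 1 * \<bar>coef p K A\<bar>"
      by (intro mult_right_mono w) simp
    finally show ?thesis by (simp add: abs_le_square_iff)
  qed
  then show "\<forall>\<^sub>F N in sequentially. (\<lambda>\<omega>. \<Sum>n<N. w n * J n \<omega>) \<in> L2 M \<and>
      (\<forall>A. finite A \<longrightarrow> (coef p (\<lambda>\<omega>. \<Sum>n<N. w n * J n \<omega>) A - coef p H A)\<^sup>2 \<le> (coef p K A)\<^sup>2)"
    using J by (intro always_eventually allI conjI L2_sum L2_cmult) auto
  show "\<forall>\<^sub>F N in sequentially. coef p (\<lambda>\<omega>. \<Sum>n<N. w n * J n \<omega>) A = coef p H A" if "finite A" for A
    using eventually_gt_at_top[of "card A"] by eventually_elim (use that in \<open>simp add: coef_N\<close>)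
qed

text \<open>Converse to \<open>is_OU_imp_coef\<close>. The components J are supplied from outside so
  that one family serves all times t.\<close>

lemma is_OU_I:
  assumes K: "K \<in> L2 M" and J: "\<And>n. J n \<in> L2 M"
    and coef_J: "\<And>n A. finite A \<Longrightarrow> coef p (J n) A = (if card A = n then coef p K A else 0)"
    and H: "H \<in> L2 M" "\<And>A. finite A \<Longrightarrow> coef p H A = exp (- real (card A) * t) * coef p K A"
    and t: "t \<ge> 0"
  shows "is_OU p t K H"
proof -
  have "is_multiple_integral p n (chaos_kernel K n) (J n)" for n
    by (rule is_multiple_integral_chaos_kernel[OF K J coef_J])
  moreover have "L2_tendsto M (\<lambda>N \<omega>. \<Sum>n<N. J n \<omega>) K sequentially"
    using weighted_chaos_tendsto[OF K J coef_J K, of "\<lambda>_. 1"] by simp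
  moreover have "L2_tendsto M (\<lambda>N \<omega>. \<Sum>n<N. exp (- real n * t) * J n \<omega>) H sequentially"
    using t by (intro weighted_chaos_tendsto[OF K J coef_J H]) auto
  ultimately show ?thesis
    unfolding is_OU_def chaos_expansion_def by blast
qed

text \<open>
  For \<open>t > 0\<close> the factors \<open>exp (- n t)\<close> are summable, so the series defining \<open>P\<^sub>t K\<close> converges
  almost surely and its pointwise sum is jointly measurable in \<open>t\<close> and \<open>\<omega>\<close>.
\<close>

theorem is_OU_process_exists:
  assumes K: "K \<in> L2 M"
  shows "\<exists>u. is_OU_process p K u"
proof -
  have "\<exists>H. H \<in> L2 M \<and> (\<forall>A. finite A \<longrightarrow> coef p H A = (if card A = n then coef p K A else 0))" for n
  proof -
    have "(\<lambda>A. (if card A = n then coef p K A else 0)\<^sup>2) summable_on Fin"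
      by (rule summable_on_comparison_test[OF coef_square_summable[OF K]]) auto
    then show ?thesis by (rule Riesz_Fischer) blast
  qed
  then obtain J where J: "\<And>n. J n \<in> L2 M"
    and coef_J: "\<And>n A. finite A \<Longrightarrow> coef p (J n) A = (if card A = n then coef p K A else 0)"
    by metis
  have [measurable]: "J n \<in> borel_measurable M" for n
    using J by (rule L2_measurable)
  have [measurable]: "K \<in> borel_measurable M"
    using K by (rule L2_measurable)
  \<comment> \<open>At t = 0 the weights give no decay and the series need not converge pointwise,
    so \<open>u 0\<close> is K itself.\<close>
  define u where "u t \<omega> = (if t \<le> 0 then K \<omega> else (\<Sum>n. exp (- real n * t) * J n \<omega>))" for t :: real and \<omega>
  have meas: "(\<lambda>(t, \<omega>). u t \<omega>) \<in> borel_measurable (restrict_space borel {0..} \<Otimes>\<^sub>M M)"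
  proof -
    have [measurable]: "fst \<in> borel_measurable (restrict_space borel {0::real..} \<Otimes>\<^sub>M M)"
      using measurable_compose[OF measurable_fst measurable_restrict_space1[OF measurable_ident]]
      by simp
    show ?thesis
      unfolding u_def case_prod_beta by measurable
  qed
  have norm_J: "(\<integral>\<omega>. (J n \<omega>)\<^sup>2 \<partial>M) \<le> (\<integral>\<omega>. (K \<omega>)\<^sup>2 \<partial>M)" for n
    by (rule L2_norm_mono_coef[OF K J]) (auto simp: coef_J)
  have pos: "integrable M (u t) \<and> (\<forall>A. finite A \<longrightarrow> coef p (u t) A = exp (- real (card A) * t) * coef p K A)"
    if t: "t > 0" for t
  proof -
    \<comment> \<open>The empty A gives integrability of \<open>u t\<close>; general A gives its
      coefficients by termwise integration.\<close>
    have sums: "integrable M (\<lambda>\<omega>. \<Sum>n. exp (- real n * t) * J n \<omega> * Yprod p A \<omega>)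
      \<and> (\<lambda>n. \<integral>\<omega>. exp (- real n * t) * J n \<omega> * Yprod p A \<omega> \<partial>M) sums
        (\<integral>\<omega>. (\<Sum>n. exp (- real n * t) * J n \<omega> * Yprod p A \<omega>) \<partial>M)
      \<and> (AE \<omega> in M. summable (\<lambda>n. norm (exp (- real n * t) * J n \<omega> * Yprod p A \<omega>)))" if A: "finite A" for A
    proof -
      have int: "integrable M (\<lambda>\<omega>. exp (- real n * t) * J n \<omega> * Yprod p A \<omega>)" for n
        using J A by (intro integrable_mult_Yprod integrable_mult_right L2_integrable)
      define C where "C = ((\<integral>\<omega>. (K \<omega>)\<^sup>2 \<partial>M) + (\<integral>\<omega>. (Yprod p A \<omega>)\<^sup>2 \<partial>M)) / 2"
      have bound: "(\<integral>\<omega>. norm (exp (- real n * t) * J n \<omega> * Yprod p A \<omega>) \<partial>M) \<le> C * exp (- t) ^ n" for n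
      proof -
        have "(\<integral>\<omega>. norm (exp (- real n * t) * J n \<omega> * Yprod p A \<omega>) \<partial>M) \<le>
            (\<integral>\<omega>. exp (- real n * t) * (((J n \<omega>)\<^sup>2 + (Yprod p A \<omega>)\<^sup>2) / 2) \<partial>M)"
        proof (rule integral_mono)
          show "integrable M (\<lambda>\<omega>. norm (exp (- real n * t) * J n \<omega> * Yprod p A \<omega>))"
            by (rule integrable_norm[OF int])
          show "integrable M (\<lambda>\<omega>. exp (- real n * t) * (((J n \<omega>)\<^sup>2 + (Yprod p A \<omega>)\<^sup>2) / 2))"
            using L2_integrable_square[OF J] L2_integrable_square[OF Yprod_L2[OF A]] by simp
          show "norm (exp (- real n * t) * J n \<omega> * Yprod p A \<omega>) \<le>
              exp (- real n * t) * (((J n \<omega>)\<^sup>2 + (Yprod p A \<omega>)\<^sup>2) / 2)" for \<omega>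
            using mult_left_mono[OF abs_mult_le_squares, of "exp (- real n * t)" "J n \<omega>" "Yprod p A \<omega>"]
            by (simp add: abs_mult mult.assoc)
        qed
        also have "\<dots> = exp (- real n * t) * (((\<integral>\<omega>. (J n \<omega>)\<^sup>2 \<partial>M) + (\<integral>\<omega>. (Yprod p A \<omega>)\<^sup>2 \<partial>M)) / 2)"
          using L2_integrable_square[OF J] L2_integrable_square[OF Yprod_L2[OF A]] by simp
        also have "\<dots> \<le> exp (- real n * t) * C"
          unfolding C_def using norm_J[of n] by (intro mult_left_mono divide_right_mono add_right_mono) auto
        also have "\<dots> = C * exp (- t) ^ n"
          by (simp add: exp_of_nat_mult[symmetric])
        finally show ?thesis .
      qed
      have norms: "summable (\<lambda>n. \<integral>\<omega>. norm (exp (- real n * t) * J n \<omega> * Yprod p A \<omega>) \<partial>M)"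
        by (rule summable_comparison_test'[where g = "\<lambda>n. C * exp (- t) ^ n"])
          (use bound t in \<open>auto intro!: summable_mult summable_geometric\<close>)
      have AE: "AE \<omega> in M. summable (\<lambda>n. norm (exp (- real n * t) * J n \<omega> * Yprod p A \<omega>))"
        by (rule AE_summable_norm[OF int norms])
      show ?thesis
        using integrable_suminf[OF int AE norms] sums_integral[OF int AE norms] AE by blast
    qed
    have int: "integrable M (u t)"
      using sums[of "{}"] t by (simp add: u_def[abs_def])
    moreover have "coef p (u t) A = exp (- real (card A) * t) * coef p K A" if A: "finite A" for A
    proof -
      have [measurable]: "u t \<in> borel_measurable M" using int by simp
      have "AE \<omega> in M. summable (\<lambda>n. norm (exp (- real n * t) * J n \<omega>))"
        using sums[of "{}"] by simp
      then have "AE \<omega> in M. u t \<omega> * Yprod p A \<omega> = (\<Sum>n. exp (- real n * t) * J n \<omega> * Yprod p A \<omega>)"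
        by eventually_elim (use t in \<open>auto simp: u_def suminf_mult2 summable_norm_cancel\<close>)
      then have "coef p (u t) A = (\<integral>\<omega>. (\<Sum>n. exp (- real n * t) * J n \<omega> * Yprod p A \<omega>) \<partial>M)"
        unfolding coef_def by (intro integral_cong_AE) auto
      moreover have "(\<lambda>n. \<integral>\<omega>. exp (- real n * t) * J n \<omega> * Yprod p A \<omega> \<partial>M) =
          (\<lambda>n. if n = card A then exp (- real (card A) * t) * coef p K A else 0)"
      proof
        fix n
        have "(\<integral>\<omega>. exp (- real n * t) * J n \<omega> * Yprod p A \<omega> \<partial>M) = exp (- real n * t) * coef p (J n) A"
          by (simp add: coef_def mult.assoc)
        then show "(\<integral>\<omega>. exp (- real n * t) * J n \<omega> * Yprod p A \<omega> \<partial>M) =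
            (if n = card A then exp (- real (card A) * t) * coef p K A else 0)"
          using A by (auto simp: coef_J)
      qed
      ultimately show ?thesis
        using sums[OF A] sums_unique2[OF _ sums_single[of "card A" "\<lambda>_. exp (- real (card A) * t) * coef p K A"]]
        by simp
    qed
    ultimately show ?thesis by blast
  qed
  have "is_OU p t K (u t)" if "t \<ge> 0" for t
  proof (cases "t = 0")
    case True
    then have "u t = K" by (simp add: u_def[abs_def])
    then show ?thesis using True by (intro is_OU_I[OF K J coef_J]) (auto simp: K)
  next
    case False
    then have t: "t > 0" using that by simp
    \<comment> \<open>So far \<open>u t\<close> is only known to be integrable. Riesz-Fischer
      supplies a square integrable function with the same coefficients, hence equal to it almost
      surely.\<close>
    have "(\<lambda>A. (exp (- real (card A) * t) * coef p K A)\<^sup>2) summable_on Fin"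
      by (rule summable_on_comparison_test[OF coef_square_summable[OF K]])
        (use t in \<open>auto simp: power_mult_distrib intro!: mult_left_le_one_le power_le_one\<close>)
    then obtain H where H: "H \<in> L2 M"
      "\<And>A. finite A \<Longrightarrow> coef p H A = exp (- real (card A) * t) * coef p K A"
      by (rule Riesz_Fischer) blast
    have AE: "AE \<omega> in M. H \<omega> = u t \<omega>"
      using pos[OF t] H by (intro coef_eq_imp_AE_eq[OF L2_integrable[OF H(1)]]) simp_all
    have "u t \<in> L2 M"
      by (rule L2_cong_AE[OF H(1) _ AE]) (use pos[OF t] in auto)
    then show ?thesis
      using pos[OF t] t by (intro is_OU_I[OF K J coef_J]) auto
  qed
  then show ?thesis
    using meas by (auto simp: is_OU_process_def)
qed

end

section \<open>Covariance identity\<close>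

text \<open>The integrand is 1 / l times the exponential density of rate l, which has mass
  1.\<close>

lemma has_bochner_integral_exp_half_line:
  fixes l :: real
  assumes l: "l > 0"
  shows "has_bochner_integral lborel (\<lambda>t. indicator {0..} t * exp (- l * t)) (1 / l)"
proof -
  interpret E: prob_space "density lborel (exponential_density l)"
    by (rule prob_space_exponential_density[OF l])
  have "(\<integral>\<^sup>+t. ennreal (exponential_density l t) \<partial>lborel) = ennreal 1"
    using E.emeasure_space_1 by (simp add: emeasure_density)
  then have "has_bochner_integral lborel (exponential_density l) 1"
    using l by (intro has_bochner_integral_nn_integral) auto
  then have "has_bochner_integral lborel (\<lambda>t. (1 / l) * exponential_density l t) ((1 / l) * 1)"
    by (intro has_bochner_integral_mult_right)
  moreover have "(1 / l) * exponential_density l t = indicator {0..} t * exp (- l * t)" for t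
    using l by (auto simp: exponential_density_def mult.commute)
  ultimately show ?thesis by simp
qed

context rademacher_product
begin

text \<open>Freezing negative times at 0 extends the process to the whole line, so that Fubini
  applies with \<open>lborel\<close>; the indicator in the time integral removes these times
  again.\<close>

lemma
  assumes u: "is_OU_process p b u"
  shows measurable_OU_process:
      "(\<lambda>(t, \<omega>). u (max 0 t) \<omega>) \<in> borel_measurable (lborel \<Otimes>\<^sub>M M)"
    and OU_process_L2: "t \<ge> 0 \<Longrightarrow> u t \<in> L2 M"
    and coef_OU_process: "t \<ge> 0 \<Longrightarrow> finite A \<Longrightarrow> coef p (u t) A = exp (- real (card A) * t) * coef p b A"
proof -
  have m: "(\<lambda>(t, \<omega>). u t \<omega>) \<in> borel_measurable (restrict_space borel {0..} \<Otimes>\<^sub>M M)"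
    using u by (simp add: is_OU_process_def)
  have "(\<lambda>z. (max 0 (fst z), snd z)) \<in> measurable (lborel \<Otimes>\<^sub>M M) (restrict_space borel {0::real..} \<Otimes>\<^sub>M M)"
    by (intro measurable_Pair measurable_restrict_space2) auto
  from measurable_compose[OF this m]
  show "(\<lambda>(t, \<omega>). u (max 0 t) \<omega>) \<in> borel_measurable (lborel \<Otimes>\<^sub>M M)"
    by (simp add: case_prod_beta)
  show "t \<ge> 0 \<Longrightarrow> u t \<in> L2 M"
    using u is_OU_imp_coef(1) by (auto simp: is_OU_process_def)
  show "t \<ge> 0 \<Longrightarrow> finite A \<Longrightarrow> coef p (u t) A = exp (- real (card A) * t) * coef p b A"
    using u is_OU_imp_coef(2) by (auto simp: is_OU_process_def)
qed

text \<open>Contractivity of the semigroup bounds the expected absolute integrand at time t by exp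
  (- t) times a constant, which gives joint integrability. At fixed t, Parseval yields a series with
  factors exp (- (|A| + 1) t); the extra 1 comes from the weight exp (- t).\<close>

lemma covariance_term:
  assumes a: "a \<in> L2 M" and b: "b \<in> L2 M" and u: "is_OU_process p b u"
  defines "I \<equiv> \<lambda>\<omega>. LINT t:{0..}|lborel. exp (- t) * a \<omega> * u t \<omega>"
  shows "AE \<omega> in M. set_integrable lborel {0..} (\<lambda>t. exp (- t) * a \<omega> * u t \<omega>)"
    and "integrable M I"
    and "(\<integral>\<omega>. norm (I \<omega>) \<partial>M) \<le> ((\<integral>\<omega>. (a \<omega>)\<^sup>2 \<partial>M) + (\<integral>\<omega>. (b \<omega>)\<^sup>2 \<partial>M)) / 2"
    and "((\<lambda>A. coef p a A * coef p b A / (real (card A) + 1)) has_sum (\<integral>\<omega>. I \<omega> \<partial>M)) Fin"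
proof -
  define \<kappa> where "\<kappa> = ((\<integral>\<omega>. (a \<omega>)\<^sup>2 \<partial>M) + (\<integral>\<omega>. (b \<omega>)\<^sup>2 \<partial>M)) / 2"
  define e where "e t = indicator {0..} t * exp (- t)" for t :: real
  define g where "g t \<omega> = e t * (a \<omega> * u (max 0 t) \<omega>)" for t \<omega>
  note uL2 = OU_process_L2[OF u] and coef_u = coef_OU_process[OF u]
  note measurable_integral = borel_measurable_lebesgue_integral
  interpret pair_sigma_finite lborel M ..
  have [measurable]: "a \<in> borel_measurable M" using a by (rule L2_measurable)
  have [measurable]: "e \<in> borel_measurable borel" unfolding e_def by measurable
  have e_nonneg: "e t \<ge> 0" for t by (simp add: e_def)
  have e_int: "has_bochner_integral lborel e 1"
    using has_bochner_integral_exp_half_line[of 1] by (simp add: e_def[abs_def])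
  have g_meas: "(\<lambda>(t, \<omega>). g t \<omega>) \<in> borel_measurable (lborel \<Otimes>\<^sub>M M)"
    unfolding g_def using measurable_OU_process[OF u] by (simp add: case_prod_beta)
  have g_eq: "indicator {0..} t *\<^sub>R (exp (- t) * a \<omega> * u t \<omega>) = g t \<omega>" for t \<omega>
    by (auto simp: g_def e_def indicator_def)
  have I_eq: "I \<omega> = (\<integral>t. g t \<omega> \<partial>lborel)" for \<omega>
    unfolding I_def set_lebesgue_integral_def g_eq ..
  have norm_u: "(\<integral>\<omega>. (u t \<omega>)\<^sup>2 \<partial>M) \<le> (\<integral>\<omega>. (b \<omega>)\<^sup>2 \<partial>M)" if "t \<ge> 0" for t
    using that
    by (intro L2_norm_mono_coef b uL2)
      (auto simp: coef_u power_mult_distrib intro!: mult_left_le_one_le power_le_one)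
  have int_au: "integrable M (\<lambda>\<omega>. a \<omega> * u (max 0 t) \<omega>)" for t
    by (intro L2_integrable_mult a uL2) simp
  have int_g: "integrable M (g t)" for t
    unfolding g_def by (intro integrable_mult_right int_au)
  have norm_g: "(\<integral>\<omega>. norm (g t \<omega>) \<partial>M) \<le> e t * \<kappa>" for t
  proof -
    have "(\<integral>\<omega>. norm (a \<omega> * u (max 0 t) \<omega>) \<partial>M) \<le> (\<integral>\<omega>. ((a \<omega>)\<^sup>2 + (u (max 0 t) \<omega>)\<^sup>2) / 2 \<partial>M)"
    proof (rule integral_mono)
      show "integrable M (\<lambda>\<omega>. norm (a \<omega> * u (max 0 t) \<omega>))"
        by (rule integrable_norm[OF int_au])
      show "integrable M (\<lambda>\<omega>. ((a \<omega>)\<^sup>2 + (u (max 0 t) \<omega>)\<^sup>2) / 2)"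
        using L2_integrable_square[OF a] L2_integrable_square[OF uL2[of "max 0 t"]] by simp
      show "norm (a \<omega> * u (max 0 t) \<omega>) \<le> ((a \<omega>)\<^sup>2 + (u (max 0 t) \<omega>)\<^sup>2) / 2" for \<omega>
        using abs_mult_le_squares by simp
    qed
    also have "\<dots> = ((\<integral>\<omega>. (a \<omega>)\<^sup>2 \<partial>M) + (\<integral>\<omega>. (u (max 0 t) \<omega>)\<^sup>2 \<partial>M)) / 2"
      using L2_integrable_square[OF a] L2_integrable_square[OF uL2[of "max 0 t"]] by simp
    also have "\<dots> \<le> \<kappa>"
      using norm_u[of "max 0 t"] by (simp add: \<kappa>_def)
    finally show ?thesis
      using e_nonneg[of t] by (simp add: g_def abs_mult mult_left_mono)
  qed
  have int_norm: "integrable lborel (\<lambda>t. \<integral>\<omega>. norm (g t \<omega>) \<partial>M)"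
  proof (rule Bochner_Integration.integrable_bound)
    show "integrable lborel (\<lambda>t. e t * \<kappa>)"
      using e_int by (intro integrable_mult_left) (simp add: has_bochner_integral_iff)
    show "(\<lambda>t. \<integral>\<omega>. norm (g t \<omega>) \<partial>M) \<in> borel_measurable lborel"
      by (rule measurable_integral) (use g_meas in \<open>simp add: case_prod_beta\<close>)
    show "AE t in lborel. norm (\<integral>\<omega>. norm (g t \<omega>) \<partial>M) \<le> norm (e t * \<kappa>)"
      using norm_g by (auto intro!: AE_I2 order_trans[OF _ abs_ge_self])
  qed
  have G: "integrable (lborel \<Otimes>\<^sub>M M) (\<lambda>(t, \<omega>). g t \<omega>)"
    by (rule Fubini_integrable) (use g_meas int_norm int_g in auto)
  show "AE \<omega> in M. set_integrable lborel {0..} (\<lambda>t. exp (- t) * a \<omega> * u t \<omega>)"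
    using AE_integrable_snd[OF G] unfolding set_integrable_def g_eq .
  show int_I: "integrable M I"
    using integrable_snd[OF G] unfolding I_eq[abs_def] .
  have G': "integrable (lborel \<Otimes>\<^sub>M M) (\<lambda>(t, \<omega>). norm (g t \<omega>))"
    using integrable_norm[OF G] by (simp add: case_prod_unfold)
  have "(\<integral>\<omega>. norm (I \<omega>) \<partial>M) \<le> (\<integral>\<omega>. (\<integral>t. norm (g t \<omega>) \<partial>lborel) \<partial>M)"
    by (rule integral_mono[OF integrable_norm[OF int_I] integrable_snd[OF G']])
      (simp only: I_eq integral_norm_bound)
  also have "\<dots> = (\<integral>t. (\<integral>\<omega>. norm (g t \<omega>) \<partial>M) \<partial>lborel)"
    by (rule Fubini_integral[OF G'])
  also have "\<dots> \<le> (\<integral>t. e t * \<kappa> \<partial>lborel)"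
    using e_int norm_g by (intro integral_mono int_norm integrable_mult_left) (auto simp: has_bochner_integral_iff)
  also have "\<dots> = \<kappa>"
    using e_int by (simp add: has_bochner_integral_iff)
  finally show "(\<integral>\<omega>. norm (I \<omega>) \<partial>M) \<le> ((\<integral>\<omega>. (a \<omega>)\<^sup>2 \<partial>M) + (\<integral>\<omega>. (b \<omega>)\<^sup>2 \<partial>M)) / 2"
    by (simp add: \<kappa>_def)

  define \<alpha> where "\<alpha> A = coef p a A * coef p b A" for A
  have abs_\<alpha>: "(\<lambda>A. \<bar>\<alpha> A\<bar>) summable_on Fin"
  proof (rule summable_on_comparison_test)
    show "(\<lambda>A. (1 / 2) * ((coef p a A)\<^sup>2 + (coef p b A)\<^sup>2)) summable_on Fin"
      by (intro summable_on_cmult_right summable_on_add coef_square_summable a b)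
  qed (use abs_mult_le_squares in \<open>auto simp: \<alpha>_def\<close>)
  define c where "c m = real (card (set_decode m)) + 1" for m
  have c: "c m \<ge> 1" for m by (simp add: c_def)
  define h where "h m t = \<alpha> (set_decode m) * (indicator {0..} t * exp (- c m * t))" for m t
  have c_int: "has_bochner_integral lborel (\<lambda>t. x * (indicator {0..} t * exp (- c m * t))) (x * (1 / c m))"
    for m x
    using c[of m] by (intro has_bochner_integral_mult_right has_bochner_integral_exp_half_line) simp
  have h_int: "has_bochner_integral lborel (h m) (\<alpha> (set_decode m) / c m)" for m
    using c_int[of "\<alpha> (set_decode m)" m] by (simp add: h_def[abs_def])
  have h_norm: "has_bochner_integral lborel (\<lambda>t. norm (h m t)) (\<bar>\<alpha> (set_decode m)\<bar> / c m)" for m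
    using c_int[of "\<bar>\<alpha> (set_decode m)\<bar>" m] by (simp add: h_def abs_mult)
  have "(\<lambda>m. \<bar>\<alpha> (set_decode m)\<bar>) summable_on UNIV"
    using abs_\<alpha> summable_on_reindex_bij_betw[OF bij_betw_set_decode, of "\<lambda>A. \<bar>\<alpha> A\<bar>"] by simp
  then have "summable (\<lambda>m. \<bar>\<alpha> (set_decode m)\<bar>)"
    by (rule summable_on_imp_summable)
  then have sum_norm: "summable (\<lambda>m. \<bar>\<alpha> (set_decode m)\<bar> / c m)"
  proof (rule summable_comparison_test')
    show "norm (\<bar>\<alpha> (set_decode m)\<bar> / c m) \<le> \<bar>\<alpha> (set_decode m)\<bar>" for m
      using c[of m] divide_left_mono[of 1 "c m" "\<bar>\<alpha> (set_decode m)\<bar>"] by simp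
  qed
  have norms: "summable (\<lambda>m. \<integral>t. norm (h m t) \<partial>lborel)"
    using sum_norm h_norm by (simp add: has_bochner_integral_iff)
  have ints: "integrable lborel (h m)" for m
    using h_int by (simp add: has_bochner_integral_iff)
  \<comment> \<open>The terms have L1 norms |\<alpha>| / c with c \<ge> 1 and \<alpha> absolutely
    summable, so the time integral may be taken term by term.\<close>
  have "(\<lambda>m. \<integral>t. h m t \<partial>lborel) sums (\<integral>t. (\<Sum>m. h m t) \<partial>lborel)"
    by (rule sums_integral[OF ints AE_summable_norm[OF ints norms] norms])
  also have "(\<lambda>t. \<Sum>m. h m t) = (\<lambda>t. \<integral>\<omega>. g t \<omega> \<partial>M)"
  proof
    fix t
    have "((\<lambda>A. coef p a A * coef p (u (max 0 t)) A) has_sum (\<integral>\<omega>. a \<omega> * u (max 0 t) \<omega> \<partial>M)) Fin"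
      by (intro Parseval_inner a uL2) simp
    then have "(\<lambda>m. coef p a (set_decode m) * coef p (u (max 0 t)) (set_decode m)) sums
        (\<integral>\<omega>. a \<omega> * u (max 0 t) \<omega> \<partial>M)"
      using has_sum_reindex_bij_betw[OF bij_betw_set_decode, of "\<lambda>A. coef p a A * coef p (u (max 0 t)) A"]
      by (auto intro: has_sum_imp_sums)
    then have "(\<lambda>m. e t * (coef p a (set_decode m) * coef p (u (max 0 t)) (set_decode m))) sums
        (e t * (\<integral>\<omega>. a \<omega> * u (max 0 t) \<omega> \<partial>M))"
      by (rule sums_mult)
    moreover have "e t * (coef p a (set_decode m) * coef p (u (max 0 t)) (set_decode m)) = h m t" for m
    proof (cases "t \<ge> 0")
      case True
      have "exp (- t) * exp (- real (card (set_decode m)) * t) = exp (- c m * t)"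
        unfolding exp_add[symmetric] c_def by (simp add: algebra_simps)
      then show ?thesis
        using True by (simp add: e_def h_def \<alpha>_def coef_u max_def algebra_simps)
    next
      case False
      then show ?thesis by (simp add: e_def h_def)
    qed
    moreover have "e t * (\<integral>\<omega>. a \<omega> * u (max 0 t) \<omega> \<partial>M) = (\<integral>\<omega>. g t \<omega> \<partial>M)"
      by (simp add: g_def)
    ultimately show "(\<Sum>m. h m t) = (\<integral>\<omega>. g t \<omega> \<partial>M)"
      by (simp add: sums_iff)
  qed
  also have "(\<integral>t. (\<integral>\<omega>. g t \<omega> \<partial>M) \<partial>lborel) = (\<integral>\<omega>. I \<omega> \<partial>M)"
    unfolding I_eq[abs_def] by (rule Fubini_integral[OF G, symmetric])
  finally have sums: "(\<lambda>m. \<alpha> (set_decode m) / c m) sums (\<integral>\<omega>. I \<omega> \<partial>M)"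
    using h_int by (simp add: has_bochner_integral_iff)
  have "((\<lambda>m. \<alpha> (set_decode m) / c m) has_sum (\<integral>\<omega>. I \<omega> \<partial>M)) UNIV"
    by (rule norm_summable_imp_has_sum[OF _ sums]) (use sum_norm c in \<open>simp add: c_def\<close>)
  then show "((\<lambda>A. coef p a A * coef p b A / (real (card A) + 1)) has_sum (\<integral>\<omega>. I \<omega> \<partial>M)) Fin"
    unfolding \<alpha>_def c_def
    using has_sum_reindex_bij_betw[OF bij_betw_set_decode,
      of "\<lambda>A. coef p a A * coef p b A / (real (card A) + 1)"] by simp
qed

text \<open>Sets containing k contribute nothing, and adding k carries the other sets A bijectively
  onto the sets B containing k, with |A| + 1 = |B|.\<close>

lemma has_sum_D_coef:
  assumes F: "integrable M F" and G: "integrable M G"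
    and sum: "((\<lambda>A. coef p (D p k F) A * coef p (D p k G) A / (real (card A) + 1)) has_sum s) Fin"
  shows "((\<lambda>B. coef p F B * coef p G B / real (card B)) has_sum s) {B \<in> Fin. k \<in> B}"
proof -
  have "((\<lambda>A. coef p (D p k F) A * coef p (D p k G) A / (real (card A) + 1)) has_sum s) {A \<in> Fin. k \<notin> A}"
    by (rule has_sum_cong_neutral[THEN iffD1, OF _ _ _ sum]) (auto simp: coef_D_mem F G)
  then show ?thesis
    by (rule has_sum_reindex_bij_witness[where i = "\<lambda>B. B - {k}" and j = "insert k", THEN iffD1, rotated -1])
      (auto simp: coef_insert F G add.commute)
qed

text \<open>
  Summing \<open>1 / |B|\<close> over the \<open>|B|\<close> elements \<open>k \<in> B\<close> recovers the full coefficient of every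
  nonempty \<open>B\<close>; the missing empty set accounts for the product of the expectations.
\<close>

lemma has_sum_Cov:
  assumes F: "F \<in> L2 M" and G: "G \<in> L2 M"
    and sum: "\<And>k. ((\<lambda>B. coef p F B * coef p G B / real (card B)) has_sum s k) {B \<in> Fin. k \<in> B}"
  shows "(s has_sum Cov M F G) UNIV"
proof -
  define \<alpha> where "\<alpha> B = coef p F B * coef p G B" for B
  have \<alpha>: "(\<alpha> has_sum (\<integral>\<omega>. F \<omega> * G \<omega> \<partial>M)) Fin"
    unfolding \<alpha>_def by (rule Parseval_inner[OF F G])
  moreover have "\<alpha> {} = (\<integral>\<omega>. F \<omega> \<partial>M) * (\<integral>\<omega>. G \<omega> \<partial>M)"
    by (simp add: \<alpha>_def coef_def)
  ultimately have cov: "(\<alpha> has_sum Cov M F G) (Fin - {{}})"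
    using has_sum_Diff[OF \<alpha> has_sum_finite[of "{{}}" \<alpha>]] by (simp add: Cov_def)
  have inner: "((\<lambda>k. c / real (card B)) has_sum c) B" if "B \<in> Fin - {{}}" for B and c :: real
    using that by (intro has_sum_finiteI) auto
  define f where "f = (\<lambda>(B, k :: nat). \<alpha> B / real (card B))"
  \<comment> \<open>Each B occurs in |B| terms of size |\<alpha> B| / |B|, so the double family is
    absolutely summable and the order of summation can be exchanged.\<close>
  have "(\<lambda>z. \<bar>f z\<bar>) summable_on (SIGMA B:Fin - {{}}. B)"
  proof (rule summable_on_SigmaI)
    show "((\<lambda>k. \<bar>f (B, k)\<bar>) has_sum \<bar>\<alpha> B\<bar>) B" if "B \<in> Fin - {{}}" for B
      using inner[OF that, of "\<bar>\<alpha> B\<bar>"] by (simp add: f_def)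
    show "(\<lambda>B. \<bar>\<alpha> B\<bar>) summable_on (Fin - {{}})"
      using cov summable_on_iff_abs_summable_on_real has_sum_imp_summable by fastforce
  qed auto
  then have "f summable_on (SIGMA B:Fin - {{}}. B)"
    by (subst summable_on_iff_abs_summable_on_real) simp
  then have "(f has_sum Cov M F G) (SIGMA B:Fin - {{}}. B)"
    by (intro has_sum_SigmaI[OF _ cov]) (auto simp: f_def intro: inner)
  then have "((\<lambda>(k, B). \<alpha> B / real (card B)) has_sum Cov M F G) (SIGMA k:UNIV. {B \<in> Fin. k \<in> B})"
    by (rule has_sum_reindex_bij_witness[where i = prod.swap and j = prod.swap, THEN iffD1, rotated -1])
      (auto simp: f_def)
  then show ?thesis
    by (rule has_sum_SigmaD) (use sum in \<open>simp add: \<alpha>_def\<close>)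
qed

text \<open>Tonelli moves the sum out of the expectation, giving the form in which the bound on the
  k-th term of the series can be summed.\<close>

lemma summable_D_norm:
  assumes F: "F \<in> L2 M" and DF: "(\<integral>\<^sup>+\<omega>. (\<Sum>k. ennreal ((D p k F \<omega>)\<^sup>2)) \<partial>M) < \<infinity>"
  shows "summable (\<lambda>k. \<integral>\<omega>. (D p k F \<omega>)\<^sup>2 \<partial>M)"
proof -
  have [measurable]: "D p k F \<in> borel_measurable M" for k
    using D_L2[OF F] by (rule L2_measurable)
  have "(\<integral>\<^sup>+\<omega>. (\<Sum>k. ennreal ((D p k F \<omega>)\<^sup>2)) \<partial>M) = (\<Sum>k. \<integral>\<^sup>+\<omega>. ennreal ((D p k F \<omega>)\<^sup>2) \<partial>M)"
    by (intro nn_integral_suminf) auto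
  also have "\<dots> = (\<Sum>k. ennreal (\<integral>\<omega>. (D p k F \<omega>)\<^sup>2 \<partial>M))"
    using L2_integrable_square[OF D_L2[OF F]] by (simp add: nn_integral_eq_integral)
  finally show ?thesis
    using DF by (intro summable_suminf_not_top) auto
qed

end

text \<open>The first conjunct keeps the second, which covers every choice of versions, from being
  vacuous. Integrability and summability are asserted because the time integral, the series and the
  expectation would otherwise take default values.\<close>

theorem proposition11p3:
  fixes p :: "nat \<Rightarrow> real" and F G :: "(nat \<Rightarrow> real) \<Rightarrow> real"
  assumes p: "\<And>k. 0 < p k \<and> p k < 1"
    and F: "F \<in> L2 (rademacher p)"
    and G: "G \<in> L2 (rademacher p)"
    and DF: "(\<integral>\<^sup>+\<omega>. (\<Sum>k. ennreal ((D p k F \<omega>)\<^sup>2)) \<partial>rademacher p) < \<infinity>"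
    and DG: "(\<integral>\<^sup>+\<omega>. (\<Sum>k. ennreal ((D p k G \<omega>)\<^sup>2)) \<partial>rademacher p) < \<infinity>"
  shows "(\<exists>PDG. \<forall>k. is_OU_process p (D p k G) (PDG k)) \<and>
    (\<forall>PDG. (\<forall>k. is_OU_process p (D p k G) (PDG k)) \<longrightarrow>
      (AE \<omega> in rademacher p.
         (\<forall>k. set_integrable lborel {0..} (\<lambda>t. exp (- t) * D p k F \<omega> * PDG k t \<omega>)) \<and>
         summable (\<lambda>k. LINT t:{0..}|lborel. exp (- t) * D p k F \<omega> * PDG k t \<omega>)) \<and>
      integrable (rademacher p)
        (\<lambda>\<omega>. \<Sum>k. LINT t:{0..}|lborel. exp (- t) * D p k F \<omega> * PDG k t \<omega>) \<and>
      Cov (rademacher p) F G =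
        (\<integral>\<omega>. (\<Sum>k. LINT t:{0..}|lborel. exp (- t) * D p k F \<omega> * PDG k t \<omega>) \<partial>rademacher p))"
proof (intro conjI allI impI)
  interpret rademacher_product p
    by unfold_locales (rule p)
  show "\<exists>PDG. \<forall>k. is_OU_process p (D p k G) (PDG k)"
    using is_OU_process_exists[OF D_L2[OF G]] by (intro choice) blast
  fix PDG assume "\<forall>k. is_OU_process p (D p k G) (PDG k)"
  then have PDG: "is_OU_process p (D p k G) (PDG k)" for k by blast
  define I where "I k \<omega> = (LINT t:{0..}|lborel. exp (- t) * D p k F \<omega> * PDG k t \<omega>)" for k \<omega>
  have int_I: "integrable M (I k)" for k
    using covariance_term(2)[OF D_L2[OF F] D_L2[OF G] PDG, of k k] by (simp add: I_def[abs_def])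
  have norms: "summable (\<lambda>k. \<integral>\<omega>. norm (I k \<omega>) \<partial>M)"
  proof (rule summable_comparison_test')
    show "summable (\<lambda>k. ((\<integral>\<omega>. (D p k F \<omega>)\<^sup>2 \<partial>M) + (\<integral>\<omega>. (D p k G \<omega>)\<^sup>2 \<partial>M)) / 2)"
      by (intro summable_divide summable_add summable_D_norm F G DF DG)
    show "norm (\<integral>\<omega>. norm (I k \<omega>) \<partial>M) \<le> ((\<integral>\<omega>. (D p k F \<omega>)\<^sup>2 \<partial>M) + (\<integral>\<omega>. (D p k G \<omega>)\<^sup>2 \<partial>M)) / 2" for k
      using covariance_term(3)[OF D_L2[OF F] D_L2[OF G] PDG, of k k] by (simp add: I_def)
  qed
  have AE_sum: "AE \<omega> in M. summable (\<lambda>k. norm (I k \<omega>))"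
    by (rule AE_summable_norm[OF int_I norms])
  have "AE \<omega> in M. \<forall>k. set_integrable lborel {0..} (\<lambda>t. exp (- t) * D p k F \<omega> * PDG k t \<omega>)"
    using covariance_term(1)[OF D_L2[OF F] D_L2[OF G] PDG] by (simp add: AE_all_countable)
  with AE_sum show "AE \<omega> in M.
      (\<forall>k. set_integrable lborel {0..} (\<lambda>t. exp (- t) * D p k F \<omega> * PDG k t \<omega>)) \<and>
      summable (\<lambda>k. LINT t:{0..}|lborel. exp (- t) * D p k F \<omega> * PDG k t \<omega>)"
    unfolding I_def[symmetric] by eventually_elim (auto intro: summable_norm_cancel)
  show "integrable M (\<lambda>\<omega>. \<Sum>k. LINT t:{0..}|lborel. exp (- t) * D p k F \<omega> * PDG k t \<omega>)"
    unfolding I_def[symmetric] by (rule integrable_suminf[OF int_I AE_sum norms])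
  have "((\<lambda>B. coef p F B * coef p G B / real (card B)) has_sum (\<integral>\<omega>. I k \<omega> \<partial>M)) {B \<in> Fin. k \<in> B}" for k
    unfolding I_def
    by (intro has_sum_D_coef covariance_term(4) L2_integrable D_L2 F G PDG)
  then have "((\<lambda>k. \<integral>\<omega>. I k \<omega> \<partial>M) has_sum Cov M F G) UNIV"
    by (rule has_sum_Cov[OF F G])
  then have "(\<lambda>k. \<integral>\<omega>. I k \<omega> \<partial>M) sums Cov M F G"
    by (rule has_sum_imp_sums)
  \<comment> \<open>The same series of expectations is evaluated twice: through coefficients as the
    covariance, and by termwise integration as the expectation of the sum.\<close>
  moreover have "(\<lambda>k. \<integral>\<omega>. I k \<omega> \<partial>M) sums (\<integral>\<omega>. (\<Sum>k. I k \<omega>) \<partial>M)"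
    by (rule sums_integral[OF int_I AE_sum norms])
  ultimately show "Cov M F G =
      (\<integral>\<omega>. (\<Sum>k. LINT t:{0..}|lborel. exp (- t) * D p k F \<omega> * PDG k t \<omega>) \<partial>M)"
    unfolding I_def[symmetric] by (rule sums_unique2)
qed

end
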